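(* Let $\Omega$ be a locally compact Hausdorff space with Borel $\sigma$-algebra $\mathcal{B}$, let $X$ be a real Banach space with dual $X^*$, and let $g,g_n:\Omega\to X$, $n\in\mathbb{N}$, be scalarly measurable functions. Let $m,m_n$, $n\in\mathbb{N}$, be measures in $\mathcal{M}(\Omega)$ with $m$ Radon. Suppose that (j) the sequence $(g_n)_n$ and the function $g$ have scalarly uniformly absolutely continuous $(m_n)$-integrals on $\Omega$; (jj) for each $x^*\in X^*$, $x^*g_n\to x^*g$ $m$-a.e. (the null set may depend on $x^*$); (jjj) $g$ is scalarly continuous, i.e. $x^*g$ is continuous for every $x^*\in X^*$; (jv) $(m_n)_n$ is vaguely convergent to $m$ and uniformly absolutely continuous with respect to $m$; (v) each $g_n$ is Pettis $m_n$-integrable. Then $g$ is Pettis $m$-integrable in $X$ and $$\lim_n x^*\Big(\int_A g_n\,dm_n\Big)=x^*\Big(\int_A g\,dm\Big)$$ for every $x^*\in X^*$ and every $A\in\mathcal{B}$.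
   Context: $\mathcal{M}(\Omega)$ denotes the family of finite nonnegative (countably additive) measures on $(\Omega,\mathcal{B})$. A measure $m\in\mathcal{M}(\Omega)$ is Radon if it is inner regular with respect to compact sets. Vague convergence of $(m_n)_n$ to $m$: $\int_\Omega h\,dm_n\to\int_\Omega h\,dm$ for every $h\in C_0(\Omega)$, the continuous real functions on $\Omega$ vanishing at infinity. $(m_n)_n$ is uniformly absolutely continuous with respect to $m$ if for each $\varepsilon>0$ there is $\delta>0$ such that for every $E\in\mathcal{B}$: $m(E)<\delta$ implies $\sup_n m_n(E)<\varepsilon$. For $g:\Omega\to X$ and $x^*\in X^*$, $x^*g$ is the function $t\mapsto x^*(g(t))$. $g$ is scalarly measurable (resp. scalarly $m$-integrable) if $x^*g$ is $\mathcal{B}$-measurable (resp. $m$-integrable) for every $x^*\in X^*$. $g$ is Pettis $m$-integrable if it is scalarly $m$-integrable and for every $A\in\mathcal{B}$ there is $\int_A g\,dm\in X$ with $x^*(\int_A g\,dm)=\int_A x^*g\,dm$ for all $x^*\in X^*$. A sequence $(g_n)_n$ with $g_n$ scalarly $m_n$-integrable for each $n$ has scalarly uniformly absolutely continuous $(m_n)$-integrals on $\Omega$ if for every $\varepsilon>0$ there is $\delta>0$ such that for every $n\in\mathbb{N}$ and $A\in\mathcal{B}$: $m_n(A)<\delta$ implies $\sup\{\int_A|x^*g_n|\,dm_n:\|x^*\|\le1\}<\varepsilon$. A single function $g$ has this property if the condition holds with $g_n:=g$ for every $n$ (in particular $g$ is then scalarly $m_n$-integrable for each $n$). *)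

theory Defs
  imports "HOL-Analysis.Analysis"
begin

text \<open>
  The locally compact Hausdorff space is a type of class \<^class>\<open>t2_space\<close>, and the dual of a real
  Banach space \<open>'x\<close> is the type of bounded linear functions from \<open>'x\<close> to \<^typ>\<open>real\<close>, with the
  operator norm.
\<close>

definition finite_borel_measures :: "'a::topological_space measure set" where
  "finite_borel_measures = {M. finite_measure M \<and> sets M = sets borel}"

definition radon_measure :: "'a::topological_space measure \<Rightarrow> bool" where
  "radon_measure M \<longleftrightarrow>
     (\<forall>B\<in>sets M. emeasure M B = (SUP K\<in>{K. compact K \<and> K \<subseteq> B}. emeasure M K))"

definition C0_functions :: "('a::topological_space \<Rightarrow> real) set" where
  "C0_functions =
     {h. continuous_on UNIV h \<and> (\<forall>\<epsilon>>0. \<exists>K. compact K \<and> (\<forall>t. t \<notin> K \<longrightarrow> \<bar>h t\<bar> < \<epsilon>))}"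

definition vaguely_convergent ::
    "(nat \<Rightarrow> 'a::topological_space measure) \<Rightarrow> 'a measure \<Rightarrow> bool" where
  "vaguely_convergent ms m \<longleftrightarrow>
     (\<forall>h\<in>C0_functions. (\<lambda>n. integral\<^sup>L (ms n) h) \<longlonglongrightarrow> integral\<^sup>L m h)"

definition uniformly_absolutely_continuous ::
    "(nat \<Rightarrow> 'a measure) \<Rightarrow> 'a measure \<Rightarrow> bool" where
  "uniformly_absolutely_continuous ms m \<longleftrightarrow>
     (\<forall>\<epsilon>::real>0. \<exists>\<delta>::real>0. \<forall>E\<in>sets m.
        emeasure m E < ennreal \<delta> \<longrightarrow> (SUP n. emeasure (ms n) E) < ennreal \<epsilon>)"

definition scalarly_measurable ::
    "'a measure \<Rightarrow> ('a \<Rightarrow> 'x::real_normed_vector) \<Rightarrow> bool" where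
  "scalarly_measurable M g \<longleftrightarrow> (\<forall>f :: 'x \<Rightarrow>\<^sub>L real. (\<lambda>t. f (g t)) \<in> borel_measurable M)"

definition scalarly_integrable ::
    "'a measure \<Rightarrow> ('a \<Rightarrow> 'x::real_normed_vector) \<Rightarrow> bool" where
  "scalarly_integrable M g \<longleftrightarrow> (\<forall>f :: 'x \<Rightarrow>\<^sub>L real. integrable M (\<lambda>t. f (g t)))"

definition scalarly_continuous ::
    "('a::topological_space \<Rightarrow> 'x::real_normed_vector) \<Rightarrow> bool" where
  "scalarly_continuous g \<longleftrightarrow> (\<forall>f :: 'x \<Rightarrow>\<^sub>L real. continuous_on UNIV (\<lambda>t. f (g t)))"

definition has_pettis_integral ::
    "'a measure \<Rightarrow> 'a set \<Rightarrow> ('a \<Rightarrow> 'x::real_normed_vector) \<Rightarrow> 'x \<Rightarrow> bool" where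
  "has_pettis_integral M A g y \<longleftrightarrow>
     (\<forall>f :: 'x \<Rightarrow>\<^sub>L real. blinfun_apply f y = (LINT t:A|M. f (g t)))"

definition pettis_integrable ::
    "'a measure \<Rightarrow> ('a \<Rightarrow> 'x::real_normed_vector) \<Rightarrow> bool" where
  "pettis_integrable M g \<longleftrightarrow>
     scalarly_integrable M g \<and> (\<forall>A\<in>sets M. \<exists>y. has_pettis_integral M A g y)"

text \<open>
  By the Hahn--Banach theorem there is at most one \<open>y\<close> with \<^prop>\<open>has_pettis_integral M A g y\<close>, so
  the choice below is no choice at all when the integral exists.
\<close>

definition pettis_integral ::
    "'a measure \<Rightarrow> 'a set \<Rightarrow> ('a \<Rightarrow> 'x::real_normed_vector) \<Rightarrow> 'x" where
  "pettis_integral M A g = (SOME y. has_pettis_integral M A g y)"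

text \<open>
  The supremum over the dual unit ball is taken in \<^typ>\<open>ennreal\<close>: in \<^typ>\<open>real\<close> the supremum of an
  unbounded set would be a meaningless default value.  For a scalarly integrable function the
  nonnegative integral of its scalarizations agrees with their Lebesgue integral.  The property for
  a single function \<open>g\<close> is the one for the constant sequence \<open>\<lambda>_. g\<close>.
\<close>

definition scalarly_uniformly_ac_integrals ::
    "(nat \<Rightarrow> 'a measure) \<Rightarrow> (nat \<Rightarrow> 'a \<Rightarrow> 'x::real_normed_vector) \<Rightarrow> bool" where
  "scalarly_uniformly_ac_integrals ms gs \<longleftrightarrow>
     (\<forall>n. scalarly_integrable (ms n) (gs n)) \<and>
     (\<forall>\<epsilon>::real>0. \<exists>\<delta>::real>0. \<forall>n. \<forall>A\<in>sets (ms n).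
        emeasure (ms n) A < ennreal \<delta> \<longrightarrow>
        (SUP f\<in>{f :: 'x \<Rightarrow>\<^sub>L real. norm f \<le> 1}.
           \<integral>\<^sup>+t\<in>A. ennreal \<bar>blinfun_apply f (gs n t)\<bar> \<partial>(ms n)) < ennreal \<epsilon>)"

end

theory Submission
  imports Defs
begin

text \<open>
  The proof has two halves, a measure-theoretic one and a functional-analytic one.
  
  Uniform absolute continuity with respect to a Radon measure turns vague convergence into
  setwise convergence: squeeze a Borel set between a compact and an open set whose difference is
  \<open>m\<close>-small, hence small for all the \<open>ms n\<close>, and test against a Urysohn function between them
  (\<open>vague_and_uniformly_ac_imp_setwise\<close>). Setwise convergence passes to integrals of bounded
  functions, and by truncation to uniformly absolutely continuous integrands. This gives a Vitali
  theorem in which integrands and measures vary together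
  (\<open>vitali_convergence_varying_measures\<close>), so that for each functional \<open>f\<close> the numbers
  \<open>f (\<integral>\<^sub>A gs n d(ms n))\<close> converge to \<open>L f = \<integral>\<^sub>A f (g t) dm\<close>.
  
  It remains to see that \<open>L\<close>, a priori only an element of the bidual, is the evaluation at a vector
  of the space. If it were not, then by Hahn-Banach there would be \<open>\<epsilon> > 0\<close> and functionals \<open>z k\<close>
  in the unit ball with \<open>L (z k) > \<epsilon>\<close> that vanish at the first \<open>k\<close> of the vectors
  \<open>x n = \<integral>\<^sub>A gs n d(ms n)\<close> (\<open>evaluation_or_separated_from_finite_sets\<close>). Suitable convex combinations
  \<open>w j\<close> of the tails of \<open>z\<close> make \<open>w j (g t)\<close> converge for almost every \<open>t\<close>
  (\<open>forward_convex_combinations_converge_AE\<close>), and a Hahn-Banach extension \<open>F\<close> of the pointwise limit of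
  the \<open>w j\<close> is a functional with \<open>F (g t) = lim (w j (g t))\<close> almost everywhere and \<open>F (x n) = 0\<close> for all
  \<open>n\<close>. Vitali gives \<open>L F = lim (L (w j)) \<ge> \<epsilon>\<close>, whereas \<open>L F = lim (F (x n)) = 0\<close>.
\<close>

section \<open>The Hahn-Banach theorem\<close>

text \<open>
  A linear functional on a subspace is represented by its graph \<open>G\<close>, a subspace of the product with
  \<open>\<real>\<close>; domination by \<open>B * norm\<close> is then a condition on points of the graph, and it already makes
  \<open>G\<close> single-valued. The number \<open>c\<close> is the value that an extension may take at \<open>x0\<close>: by the triangle
  inequality every lower bound on it, coming from \<open>t < 0\<close>, is below every upper bound, coming from
  \<open>t > 0\<close>.
\<close>

lemma dominated_graph_one_step:
  fixes G :: "('x::real_normed_vector \<times> real) set"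
  assumes G: "subspace G" and dom: "\<And>x r. (x, r) \<in> G \<Longrightarrow> r \<le> B * norm x" and "B \<ge> 0"
  obtains c where "\<And>x r t. (x, r) \<in> G \<Longrightarrow> r + t * c \<le> B * norm (x + t *\<^sub>R x0)"
proof -
  define S where "S = (\<lambda>(x, r). r - B * norm (x - x0)) ` G"
  have gap: "r - B * norm (x - x0) \<le> B * norm (y + x0) - s"
    if "(x, r) \<in> G" "(y, s) \<in> G" for x r y s
  proof -
    have "r + s \<le> B * norm (x + y)"
      using dom subspace_add[OF G that] by simp
    also have "\<dots> \<le> B * (norm (x - x0) + norm (y + x0))"
      using norm_triangle_ineq[of "x - x0" "y + x0"] \<open>B \<ge> 0\<close> by (intro mult_left_mono) auto
    finally show ?thesis
      by (simp add: algebra_simps)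
  qed
  have zero: "(0, 0) \<in> G"
    using subspace_0[OF G] by (simp add: zero_prod_def)
  have ne: "S \<noteq> {}" using zero by (auto simp: S_def)
  have bdd: "bdd_above S"
    by (rule bdd_aboveI[of _ "B * norm x0"]) (use gap[OF _ zero] in \<open>auto simp: S_def\<close>)
  have lower: "r - B * norm (x - x0) \<le> Sup S" if "(x, r) \<in> G" for x r
    by (rule cSup_upper[OF _ bdd]) (use that in \<open>force simp: S_def\<close>)
  have upper: "Sup S \<le> B * norm (y + x0) - s" if "(y, s) \<in> G" for y s
    by (rule cSup_least[OF ne]) (use gap that in \<open>auto simp: S_def\<close>)
  have "r + t * Sup S \<le> B * norm (x + t *\<^sub>R x0)" if xr: "(x, r) \<in> G" for x r t
  proof -
    consider "t = 0" | "t > 0" | "t < 0" by linarith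
    then show ?thesis
    proof cases
      case 1 then show ?thesis using dom[OF xr] by simp
    next
      case 2
      have "(x /\<^sub>R t, r / t) \<in> G"
        using subspace_scale[OF G xr, of "inverse t"] by (simp add: field_simps)
      from upper[OF this] have "t * Sup S \<le> t * (B * norm (x /\<^sub>R t + x0) - r / t)"
        using 2 by (intro mult_left_mono) auto
      also have "\<dots> = B * (t * norm (x /\<^sub>R t + x0)) - r"
        using 2 by (simp add: algebra_simps)
      also have "t * norm (x /\<^sub>R t + x0) = norm (x + t *\<^sub>R x0)"
        using 2 norm_scaleR[of t "x /\<^sub>R t + x0"] by (simp add: scaleR_add_right)
      finally show ?thesis by simp
    next
      case 3
      have "(x /\<^sub>R (-t), r / (-t)) \<in> G"
        using subspace_scale[OF G xr, of "inverse (-t)"] by (simp add: field_simps)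
      from lower[OF this]
      have "(-t) * (r / (-t) - B * norm (x /\<^sub>R (-t) - x0)) \<le> (-t) * Sup S"
        using 3 by (intro mult_left_mono) auto
      also have "(-t) * (r / (-t) - B * norm (x /\<^sub>R (-t) - x0))
          = r - B * ((-t) * norm (x /\<^sub>R (-t) - x0))"
        using 3 by (simp add: algebra_simps)
      also have "(-t) * norm (x /\<^sub>R (-t) - x0) = norm (x + t *\<^sub>R x0)"
        using 3 norm_scaleR[of "-t" "x /\<^sub>R (-t) - x0"] by (simp add: scaleR_diff_right)
      finally show ?thesis by simp
    qed
  qed
  then show ?thesis by (rule that)
qed

text \<open>
  Zorn's lemma yields a maximal dominated graph, and \<open>dominated_graph_one_step\<close> shows that a maximal
  graph is total: otherwise the span of the graph and one more point would be larger.
\<close>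

theorem hahn_banach_extension:
  fixes S :: "'x::real_normed_vector set" and f :: "'x \<Rightarrow> real"
  assumes S: "subspace S"
    and add: "\<And>x y. x \<in> S \<Longrightarrow> y \<in> S \<Longrightarrow> f (x + y) = f x + f y"
    and scale: "\<And>c x. x \<in> S \<Longrightarrow> f (c *\<^sub>R x) = c * f x"
    and dom: "\<And>x. x \<in> S \<Longrightarrow> \<bar>f x\<bar> \<le> B * norm x" and "B \<ge> 0"
  obtains F :: "'x \<Rightarrow>\<^sub>L real" where "\<And>x. x \<in> S \<Longrightarrow> F x = f x" "norm F \<le> B"
proof -
  define G0 where "G0 = {(x, r). x \<in> S \<and> r = f x}"
  define \<G> where "\<G> = {G. subspace G \<and> G0 \<subseteq> G \<and> (\<forall>x r. (x, r) \<in> G \<longrightarrow> r \<le> B * norm x)}"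
  have "f 0 = 0" using scale[of 0 0] S by (simp add: subspace_0)
  then have "subspace G0"
    using S add scale
    by (intro subspaceI) (auto simp: G0_def zero_prod_def subspace_0 subspace_add subspace_scale)
  then have "G0 \<in> \<G>"
    using dom by (force simp: \<G>_def G0_def)
  moreover have "\<Union>C \<in> \<G>" if "C \<noteq> {}" "subset.chain \<G> C" for C
  proof -
    have sub: "\<And>G. G \<in> C \<Longrightarrow> G \<in> \<G>" and lin: "\<And>G H. G \<in> C \<Longrightarrow> H \<in> C \<Longrightarrow> G \<subseteq> H \<or> H \<subseteq> G"
      using that(2) by (auto simp: subset_chain_def)
    have subC: "subspace G" if "G \<in> C" for G using sub[OF that] by (simp add: \<G>_def)
    have "subspace (\<Union>C)"
    proof (rule subspaceI)
      show "0 \<in> \<Union>C" using that(1) subC subspace_0 by blast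
    next
      fix a b assume "a \<in> \<Union>C" "b \<in> \<Union>C"
      then obtain H where "H \<in> C" "a \<in> H" "b \<in> H" using lin by blast
      then show "a + b \<in> \<Union>C" using subspace_add[OF subC] by blast
    next
      fix c a assume "a \<in> \<Union>C"
      then show "c *\<^sub>R a \<in> \<Union>C" using subspace_scale[OF subC] by blast
    qed
    moreover have "G0 \<subseteq> \<Union>C" using sub that(1) by (auto simp: \<G>_def)
    moreover have "r \<le> B * norm x" if "(x, r) \<in> \<Union>C" for x r
      using sub that by (auto simp: \<G>_def)
    ultimately show ?thesis by (simp add: \<G>_def)
  qed
  ultimately obtain G where G: "G \<in> \<G>" and max: "\<And>H. H \<in> \<G> \<Longrightarrow> G \<subseteq> H \<Longrightarrow> H = G"
    using subset_Zorn_nonempty[of \<G>] by blast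
  have subG: "subspace G" and "G0 \<subseteq> G" and domG: "\<And>x r. (x, r) \<in> G \<Longrightarrow> r \<le> B * norm x"
    using G by (auto simp: \<G>_def)
  \<comment> \<open>the difference of two values at the same point is a value at \<open>0\<close>, dominated by \<open>B * 0\<close>\<close>
  have single: "r = s" if "(x, r) \<in> G" "(x, s) \<in> G" for x r s
    using domG[of 0 "r - s"] domG[of 0 "s - r"] subspace_diff[OF subG that]
      subspace_diff[OF subG that(2) that(1)] by simp
  have total: "\<exists>r. (x0, r) \<in> G" for x0
  proof -
    obtain c where c: "\<And>x r t. (x, r) \<in> G \<Longrightarrow> r + t * c \<le> B * norm (x + t *\<^sub>R x0)"
      using dominated_graph_one_step[OF subG domG \<open>B \<ge> 0\<close>] by metis
    define H where "H = span (insert (x0, c) G)"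
    have "r \<le> B * norm x" if xr: "(x, r) \<in> H" for x r
    proof -
      obtain k where "(x, r) - k *\<^sub>R (x0, c) \<in> span G"
        using xr unfolding H_def span_insert by blast
      then have "(x - k *\<^sub>R x0, r - k * c) \<in> G"
        using span_eq_iff[THEN iffD2, OF subG] by simp
      from c[OF this, of k] show ?thesis by simp
    qed
    moreover have "G \<subseteq> H" by (auto simp: H_def intro: span_base)
    ultimately have "H = G"
      using \<open>G0 \<subseteq> G\<close> by (intro max) (auto simp: \<G>_def H_def)
    then show ?thesis by (metis H_def insertI1 span_base)
  qed
  obtain F where F: "\<And>x. (x, F x) \<in> G" using total by metis
  have eqF: "F x = r" if "(x, r) \<in> G" for x r using single[OF F that] .
  have "F (x + y) = F x + F y" for x y
    by (rule eqF) (use subspace_add[OF subG F F, of x y] in simp)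
  moreover have "F (c *\<^sub>R x) = c *\<^sub>R F x" for c x
    by (rule eqF) (use subspace_scale[OF subG F, of c x] in simp)
  moreover have bnd: "norm (F x) \<le> B * norm x" for x
    using domG[OF F, of x] domG[of "-x" "- F x"] subspace_neg[OF subG F, of x] by simp
  ultimately have bl: "bounded_linear F"
    by (intro bounded_linear_intro[where K = B]) (auto simp: mult.commute)
  show ?thesis
  proof
    show "blinfun_apply (Blinfun F) x = f x" if "x \<in> S" for x
      using \<open>G0 \<subseteq> G\<close> that bl by (auto simp: bounded_linear_Blinfun_apply G0_def intro!: eqF)
    show "norm (Blinfun F) \<le> B"
      using bnd bl \<open>B \<ge> 0\<close> by (intro norm_blinfun_bound) (auto simp: bounded_linear_Blinfun_apply)
  qed
qed

text \<open>
  Hahn-Banach, applied on the line through \<open>y\<close> to \<open>c *\<^sub>R y \<mapsto> c * norm y\<close>.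
\<close>

lemma norming_functional:
  fixes y :: "'x::real_normed_vector"
  obtains f :: "'x \<Rightarrow>\<^sub>L real" where "norm f \<le> 1" "f y = norm y"
proof (cases "y = 0")
  case True
  then show ?thesis by (intro that[of 0]) auto
next
  case False
  define f where "f x = (THE c. x = c *\<^sub>R y) * norm y" for x
  have f: "f (c *\<^sub>R y) = c * norm y" for c
  proof -
    have "(THE d. c *\<^sub>R y = d *\<^sub>R y) = c" using False by (intro the_equality) auto
    then show ?thesis by (simp add: f_def)
  qed
  obtain F :: "'x \<Rightarrow>\<^sub>L real" where F: "\<And>x. x \<in> span {y} \<Longrightarrow> F x = f x" "norm F \<le> 1"
  proof (rule hahn_banach_extension[of "span {y}" f 1])
    fix u v assume "u \<in> span {y}" "v \<in> span {y}"
    then obtain a b where "u = a *\<^sub>R y" "v = b *\<^sub>R y" by (auto simp: span_singleton)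
    then show "f (u + v) = f u + f v"
      using f[of "a + b"] f[of a] f[of b] by (simp add: scaleR_add_left algebra_simps)
  next
    fix c u assume "u \<in> span {y}"
    then obtain a where "u = a *\<^sub>R y" by (auto simp: span_singleton)
    then show "f (c *\<^sub>R u) = c * f u" using f[of "c * a"] f[of a] by simp
  next
    fix u assume "u \<in> span {y}"
    then obtain a where "u = a *\<^sub>R y" by (auto simp: span_singleton)
    then show "\<bar>f u\<bar> \<le> 1 * norm u" using f[of a] by (simp add: abs_mult)
  qed auto
  then show ?thesis using f[of 1] span_base[of y "{y}"] by (intro that[of F]) auto
qed

section \<open>Evaluation functionals on the dual space\<close>

text \<open>
  A linear functional that vanishes on the common kernel of finitely many others is a linear
  combination of them; here the others are the evaluations at the points of \<open>A\<close>, whose linear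
  combinations are again evaluations. The induction step subtracts from \<open>L\<close> the multiple of the new
  evaluation that makes it vanish on a functional dual to the new point.
\<close>

lemma evaluation_if_vanishes_on_common_kernel:
  fixes L :: "('x::real_normed_vector \<Rightarrow>\<^sub>L real) \<Rightarrow> real"
  assumes "finite A" "linear L"
    and "\<And>f. (\<And>x. x \<in> A \<Longrightarrow> blinfun_apply f x = 0) \<Longrightarrow> L f = 0"
  shows "\<exists>y. \<forall>f. L f = blinfun_apply f y"
  using assms
proof (induction A arbitrary: L rule: finite_induct)
  case empty
  then show ?case by (intro exI[of _ 0]) auto
next
  case (insert x A)
  interpret L: linear L by fact
  show ?case
  proof (cases "\<exists>f :: 'x \<Rightarrow>\<^sub>L real. (\<forall>u\<in>A. f u = 0) \<and> f x \<noteq> 0")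
    case False
    then show ?thesis using insert.IH[OF insert.prems(1)] insert.prems(2) by blast
  next
    case True
    then obtain f1 :: "'x \<Rightarrow>\<^sub>L real" where f1: "\<forall>u\<in>A. f1 u = 0" "f1 x \<noteq> 0" by blast
    define f0 where "f0 = f1 /\<^sub>R f1 x"
    have f0: "\<And>u. u \<in> A \<Longrightarrow> f0 u = 0" "f0 x = 1"
      using f1 by (auto simp: f0_def blinfun.scaleR_left)
    define L' where "L' f = L f - blinfun_apply f x * L f0" for f
    have "linear L'"
      by (rule linearI) (auto simp: L'_def L.add L.scale blinfun.add_left blinfun.scaleR_left algebra_simps)
    moreover have "L' f = 0" if "\<And>u. u \<in> A \<Longrightarrow> blinfun_apply f u = 0" for f
    proof -
      have "L (f - f x *\<^sub>R f0) = 0"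
        by (rule insert.prems(2)) (use that f0 in \<open>auto simp: blinfun.diff_left blinfun.scaleR_left\<close>)
      then show ?thesis by (simp add: L'_def L.diff L.scale)
    qed
    ultimately obtain y where y: "\<forall>f. L' f = blinfun_apply f y" using insert.IH by blast
    have "L f = blinfun_apply f (y + L f0 *\<^sub>R x)" for f
      using y[rule_format, of f] by (simp add: L'_def blinfun.add_right blinfun.scaleR_right algebra_simps)
    then show ?thesis by blast
  qed
qed

text \<open>
  If for some \<open>\<epsilon>\<close> and some finite \<open>A\<close> no such functional exists, then \<open>L\<close> has norm at most \<open>\<epsilon>\<close> on the
  annihilator of \<open>A\<close>. Subtracting from \<open>L\<close> a Hahn-Banach extension of that restriction leaves a
  functional vanishing on the annihilator, hence an evaluation, and this evaluation is within \<open>\<epsilon>\<close> of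
  \<open>L\<close> on the unit ball. If this happens for all \<open>\<epsilon>\<close>, the approximating points form a Cauchy sequence
  and \<open>L\<close> is the evaluation at their limit.
\<close>

theorem evaluation_or_separated_from_finite_sets:
  fixes L :: "('x::banach \<Rightarrow>\<^sub>L real) \<Rightarrow> real"
  assumes L: "linear L" and not_eval: "\<nexists>y. \<forall>f. L f = blinfun_apply f y"
  obtains \<epsilon> where "\<epsilon> > 0"
    "\<And>A. finite A \<Longrightarrow> \<exists>f. norm f \<le> 1 \<and> (\<forall>x\<in>A. blinfun_apply f x = 0) \<and> L f > \<epsilon>"
proof (rule ccontr)
  note separated = that
  assume "\<not> thesis"
  then have small: "\<exists>A. finite A \<and> (\<forall>f. norm f \<le> 1 \<longrightarrow> (\<forall>x\<in>A. blinfun_apply f x = 0) \<longrightarrow> L f \<le> \<epsilon>)"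
    if "\<epsilon> > 0" for \<epsilon> :: real using separated[of \<epsilon>] that by (metis not_less)
  interpret L: linear L by fact
  have approx: "\<exists>y. \<forall>f. \<bar>L f - blinfun_apply f y\<bar> \<le> \<epsilon> * norm f" if "\<epsilon> > 0" for \<epsilon> :: real
  proof -
    obtain A where A: "finite A"
      and AL: "\<And>f. norm f \<le> 1 \<Longrightarrow> (\<forall>x\<in>A. blinfun_apply f x = 0) \<Longrightarrow> L f \<le> \<epsilon>"
      using small[OF \<open>\<epsilon> > 0\<close>] by blast
    define N where "N = {f :: 'x \<Rightarrow>\<^sub>L real. \<forall>x\<in>A. f x = 0}"
    have N: "subspace N"
      by (rule subspaceI) (auto simp: N_def blinfun.add_left blinfun.scaleR_left)
    have half: "L f \<le> \<epsilon> * norm f" if "f \<in> N" for f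
    proof (cases "f = 0")
      case True then show ?thesis by (simp add: L.zero)
    next
      case False
      have "L (f /\<^sub>R norm f) \<le> \<epsilon>"
        by (rule AL) (use that False in \<open>auto simp: N_def blinfun.scaleR_left\<close>)
      then show ?thesis using False by (simp add: L.scale field_simps)
    qed
    have bnd: "\<bar>L f\<bar> \<le> \<epsilon> * norm f" if "f \<in> N" for f
      using half[OF that] half[OF subspace_neg[OF N that]] by (auto simp: L.neg abs_le_iff)
    obtain M where M: "\<And>f. f \<in> N \<Longrightarrow> blinfun_apply M f = L f" "norm M \<le> \<epsilon>"
      using hahn_banach_extension[OF N, of L \<epsilon>] bnd \<open>\<epsilon> > 0\<close> by (auto simp: L.add L.scale)
    have "linear (\<lambda>f. L f - M f)"
      by (rule linearI) (auto simp: L.add L.scale blinfun.add_right blinfun.scaleR_right algebra_simps)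
    then obtain y where y: "\<And>f. L f - M f = blinfun_apply f y"
      using evaluation_if_vanishes_on_common_kernel[OF A, of "\<lambda>f. L f - M f"] M(1)
      by (auto simp: N_def)
    have "\<bar>L f - blinfun_apply f y\<bar> \<le> \<epsilon> * norm f" for f
    proof -
      have "L f - blinfun_apply f y = M f" using y[of f] by simp
      then show ?thesis
        using norm_blinfun[of M f] M(2) mult_right_mono[OF M(2), of "norm f"] by simp
    qed
    then show ?thesis by blast
  qed
  have "\<forall>n. \<exists>y. \<forall>f. \<bar>L f - blinfun_apply f y\<bar> \<le> inverse (real (Suc n)) * norm f"
    by (intro allI approx) simp
  then obtain y where y: "\<And>n f. \<bar>L f - blinfun_apply f (y n)\<bar> \<le> inverse (real (Suc n)) * norm f"
    by metis
  have dist: "norm (y i - y j) \<le> inverse (real (Suc i)) + inverse (real (Suc j))" for i j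
  proof -
    obtain f :: "'x \<Rightarrow>\<^sub>L real" where f: "norm f \<le> 1" "f (y i - y j) = norm (y i - y j)"
      using norming_functional by blast
    have "inverse (real (Suc n)) * norm f \<le> inverse (real (Suc n))" for n
      using f(1) mult_left_mono[OF f(1), of "inverse (real (Suc n))"] by simp
    then have "\<bar>L f - f (y n)\<bar> \<le> inverse (real (Suc n))" for n
      using y[of f n] order_trans by blast
    from this[of i] this[of j] show ?thesis
      using f(2) by (simp add: blinfun.diff_right)
  qed
  have "Cauchy y"
  proof (rule CauchyI)
    fix e :: real assume "e > 0"
    then obtain N where N: "inverse (real (Suc N)) < e / 2" using reals_Archimedean[of "e/2"] by auto
    have "norm (y i - y j) < e" if "i \<ge> N" "j \<ge> N" for i j
    proof -
      have "inverse (real (Suc i)) \<le> inverse (real (Suc N))" "inverse (real (Suc j)) \<le> inverse (real (Suc N))"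
        using that by (auto intro!: le_imp_inverse_le)
      then show ?thesis using dist[of i j] N by linarith
    qed
    then show "\<exists>N. \<forall>i\<ge>N. \<forall>j\<ge>N. norm (y i - y j) < e" by blast
  qed
  then obtain z where z: "y \<longlonglongrightarrow> z" using Cauchy_convergent convergent_def by blast
  have "L f = blinfun_apply f z" for f
  proof (rule LIMSEQ_unique)
    show "(\<lambda>n. blinfun_apply f (y n)) \<longlonglongrightarrow> blinfun_apply f z" by (intro tendsto_intros z)
    have "(\<lambda>n. blinfun_apply f (y n) - L f) \<longlonglongrightarrow> 0"
    proof (rule Lim_null_comparison)
      show "\<forall>\<^sub>F n in sequentially. norm (blinfun_apply f (y n) - L f) \<le> inverse (real (Suc n)) * norm f"
        using y[of f] by (simp add: abs_minus_commute)
      show "(\<lambda>n. inverse (real (Suc n)) * norm f) \<longlonglongrightarrow> 0"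
        using tendsto_mult_right[OF LIMSEQ_inverse_real_of_nat, of "norm f"] by simp
    qed
    then show "(\<lambda>n. blinfun_apply f (y n)) \<longlonglongrightarrow> L f" by (simp add: LIM_zero_iff)
  qed
  with not_eval show False by blast
qed

section \<open>Convex combinations that converge almost everywhere\<close>

lemma abs_le_scaled_square:
  fixes a b :: real
  assumes "q > 0"
  shows "\<bar>a\<bar> \<le> (a\<^sup>2 / q + q) / 2"
proof -
  have "0 \<le> (\<bar>a\<bar> - q)\<^sup>2 / q" using assms by simp
  also have "\<dots> = a\<^sup>2 / q + q - 2 * \<bar>a\<bar>"
    using assms by (simp add: field_simps power2_eq_square)
  finally show ?thesis by simp
qed

text \<open>
  The idea is that of the projection theorem in a Hilbert space. Dividing by a measurable function
  \<open>G \<ge> 1\<close> that dominates the whole sequence pointwise makes the functions \<open>u (z k) = T (z k) / G\<close>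
  bounded by \<open>1\<close>, hence square integrable. Let \<open>a j\<close> be the infimum of the squared norms over the
  convex hull of the \<open>j\<close>-th tail, and pick almost minimal elements \<open>w p\<close>. The sequence \<open>a\<close> increases to
  a finite limit \<open>s\<close>, so by the parallelogram identity almost minimal elements of late tails are close
  to each other. Choosing the tails late enough makes consecutive differences summable almost
  everywhere, and multiplying by \<open>G\<close> gives convergence of the original functions.
\<close>

theorem forward_convex_combinations_converge_AE:
  fixes T :: "'v::real_vector \<Rightarrow> 'a \<Rightarrow> real" and z :: "nat \<Rightarrow> 'v"
  assumes "finite_measure M"
    and lin: "\<And>t. linear (\<lambda>v. T v t)"
    and meas[measurable]: "\<And>v. T v \<in> borel_measurable M"
    and bdd: "\<And>t. bdd_above (range (\<lambda>k. \<bar>T (z k) t\<bar>))"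
  obtains w where "\<And>j. w j \<in> convex hull (z ` {j..})" "AE t in M. convergent (\<lambda>j. T (w j) t)"
proof -
  interpret finite_measure M by fact
  define G where "G t = 1 + (SUP k. \<bar>T (z k) t\<bar>)" for t
  have [measurable]: "G \<in> borel_measurable M"
    unfolding G_def by (intro borel_measurable_add borel_measurable_const borel_measurable_cSUP) (auto intro: bdd)
  have zG: "\<bar>T (z k) t\<bar> \<le> G t - 1" for k t
    using cSUP_upper[OF UNIV_I bdd, of k t] by (simp add: G_def)
  have G1: "G t \<ge> 1" for t using zG[of 0 t] by linarith
  define C where "C j = convex hull (z ` {j..})" for j
  have C_mono: "C j \<subseteq> C i" if "i \<le> j" for i j
    unfolding C_def by (rule hull_mono) (use that in auto)
  have C_ne: "C j \<noteq> {}" for j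
    by (auto simp: C_def)
  define u where "u v t = T v t / G t" for v t
  have [measurable]: "u v \<in> borel_measurable M" for v unfolding u_def by measurable
  have u1: "\<bar>u v t\<bar> \<le> 1" if "v \<in> C j" for v t j
  proof -
    have "convex ((\<lambda>v. T v t) -` {- G t..G t})" by (intro convex_linear_vimage lin) simp
    moreover have "z ` {j..} \<subseteq> (\<lambda>v. T v t) -` {- G t..G t}"
    proof (intro image_subsetI vimageI2)
      fix k show "T (z k) t \<in> {- G t..G t}" using zG[of k t] by (auto simp: abs_le_iff)
    qed
    ultimately have "v \<in> (\<lambda>v. T v t) -` {- G t..G t}"
      using that hull_minimal[of "z ` {j..}" _ convex] unfolding C_def by blast
    then show ?thesis using G1[of t] by (auto simp: u_def abs_le_iff field_simps)
  qed
  define N where "N v = (\<integral>t. (u v t)\<^sup>2 \<partial>M)" for v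
  have sq1: "(u v t)\<^sup>2 \<le> 1" if "v \<in> C j" for v t j
    using u1[OF that, of t] by (simp add: abs_square_le_1)
  have int: "integrable M (\<lambda>t. (u v t)\<^sup>2)" if "v \<in> C j" for v j
    by (rule integrable_const_bound[where B = 1]) (use sq1[OF that] in auto)
  have N0: "N v \<ge> 0" for v by (simp add: N_def)
  have N1: "N v \<le> measure M (space M)" if "v \<in> C j" for v j
    using integral_mono[OF int[OF that], of "\<lambda>_. 1"] sq1[OF that] by (simp add: N_def)
  define a where "a j = (INF v\<in>C j. N v)" for j
  have bddN: "bdd_below (N ` A)" for A using N0 by (auto simp: bdd_below_def)
  have a_le: "a j \<le> N v" if "v \<in> C j" for v j
    unfolding a_def by (rule cINF_lower[OF bddN that])
  have a_inc: "a i \<le> a j" if "i \<le> j" for i j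
    unfolding a_def by (rule cINF_superset_mono[OF C_ne bddN C_mono[OF that]]) simp
  have a_bdd: "bdd_above (range a)"
  proof -
    have "a j \<le> measure M (space M)" for j
      using C_ne[of j] a_le[of _ j] N1[of _ j] by (meson equals0I order_trans)
    then show ?thesis by (auto simp: bdd_above_def)
  qed
  define s where "s = (SUP j. a j)"
  have a_s: "a j \<le> s" for j unfolding s_def by (rule cSUP_upper[OF _ a_bdd]) simp
  have "\<forall>p. \<exists>j. s - (1/4)^p < a j"
  proof
    fix p :: nat
    have "s - (1/4)^p < s" by simp
    then show "\<exists>j. s - (1/4)^p < a j"
      unfolding s_def using less_cSUP_iff[OF _ a_bdd] by auto
  qed
  then obtain J where J: "\<And>p. s - (1/4)^p < a (J p)" by metis
  \<comment> \<open>a monotone sequence of indices that are at least \<open>J p\<close> and at least \<open>p\<close>\<close>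
  define I where "I p = p + (\<Sum>i\<le>p. J i)" for p :: nat
  have IJ: "J p \<le> I p" for p
    unfolding I_def by (intro trans_le_add2 member_le_sum) auto
  have I_Suc: "I p \<le> I (Suc p)" and I_p: "p \<le> I p" for p by (auto simp: I_def)
  have "\<forall>p. \<exists>v\<in>C (I p). N v < a (I p) + (1/4)^p"
  proof
    fix p
    have "(INF v\<in>C (I p). N v) < a (I p) + (1/4)^p" by (simp add: a_def)
    then show "\<exists>v\<in>C (I p). N v < a (I p) + (1/4)^p"
      using cINF_less_iff[OF C_ne bddN] by auto
  qed
  then obtain w where wC: "\<And>p. w p \<in> C (I p)" and wN: "\<And>p. N (w p) < a (I p) + (1/4)^p"
    by metis
  define d where "d p t = u (w (Suc p)) t - u (w p) t" for p t
  have [measurable]: "d p \<in> borel_measurable M" for p unfolding d_def by measurable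
  have d_int: "integrable M (\<lambda>t. (d p t)\<^sup>2)" "(\<integral>t. (d p t)\<^sup>2 \<partial>M) \<le> 8 * (1/4)^p" for p
  proof -
    let ?v = "w p" and ?v' = "w (Suc p)"
    define x where "x = (1/2) *\<^sub>R ?v + (1/2) *\<^sub>R ?v'"
    have v': "?v' \<in> C (I p)" using C_mono[OF I_Suc] wC by blast
    have x: "x \<in> C (I p)"
      unfolding x_def using wC[of p] v' convex_convex_hull[of "z ` {I p..}"]
      by (auto simp: C_def intro!: convexD)
    \<comment> \<open>the parallelogram identity; the midpoint \<open>x\<close> lies in the same convex hull, so \<open>N x\<close> is at least \<open>a (I p)\<close>\<close>
    have eq: "(d p t)\<^sup>2 = 2 * (u ?v t)\<^sup>2 + 2 * (u ?v' t)\<^sup>2 - 4 * (u x t)\<^sup>2" for t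
    proof -
      have "T x t = (T ?v t + T ?v' t) / 2"
        unfolding x_def using linear_add[OF lin[of t], of "(1/2) *\<^sub>R ?v" "(1/2) *\<^sub>R ?v'"]
          linear_scale[OF lin[of t], of "1/2"] by simp
      then have mid: "u x t = (u ?v t + u ?v' t) / 2"
        by (simp add: u_def add_divide_distrib)
      show ?thesis unfolding d_def mid by (simp add: power2_eq_square field_simps)
    qed
    note ints = int[OF wC[of p]] int[OF v'] int[OF x]
    show "integrable M (\<lambda>t. (d p t)\<^sup>2)" unfolding eq using ints by simp
    have "(\<integral>t. (d p t)\<^sup>2 \<partial>M) = 2 * N ?v + 2 * N ?v' - 4 * N x"
      unfolding eq N_def using ints by simp
    also have "\<dots> \<le> 2 * (s + (1/4)^p) + 2 * (s + (1/4)^p) - 4 * (s - (1/4)^p)"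
    proof -
      have "N ?v \<le> s + (1/4)^p" using wN[of p] a_s[of "I p"] by simp
      moreover have "(1/4::real) ^ Suc p \<le> (1/4) ^ p" by simp
      then have "N ?v' \<le> s + (1/4)^p" using wN[of "Suc p"] a_s[of "I (Suc p)"] by linarith
      moreover have "s - (1/4)^p \<le> N x"
        using J[of p] a_inc[OF IJ[of p]] a_le[OF x] by linarith
      moreover have "2 * b + 2 * b' - 4 * c \<le> 2 * (s + q) + 2 * (s + q) - 4 * (s - q)"
        if "b \<le> s + q" "b' \<le> s + q" "s - q \<le> c" for b b' c q using that by (simp add: algebra_simps)
      ultimately show ?thesis by blast
    qed
    finally show "(\<integral>t. (d p t)\<^sup>2 \<partial>M) \<le> 8 * (1/4)^p" by simp
  qed
  let ?K = "4 + measure M (space M) / 2"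
  \<comment> \<open>the scale \<open>(1/2)^p\<close> balances the two terms of \<open>abs_le_scaled_square\<close>, since the squared norm of \<open>d p\<close>
    is of order \<open>(1/4)^p\<close>\<close>
  have d1: "(\<integral>\<^sup>+t. ennreal \<bar>d p t\<bar> \<partial>M) \<le> ennreal ((1/2)^p * ?K)" for p
  proof -
    let ?q = "(1/2)^p :: real"
    have "(\<integral>\<^sup>+t. ennreal \<bar>d p t\<bar> \<partial>M) \<le> (\<integral>\<^sup>+t. ennreal (((d p t)\<^sup>2 / ?q + ?q) / 2) \<partial>M)"
      by (intro nn_integral_mono ennreal_leI abs_le_scaled_square) simp
    also have "\<dots> = ennreal (\<integral>t. ((d p t)\<^sup>2 / ?q + ?q) / 2 \<partial>M)"
      using d_int(1)[of p] by (intro nn_integral_eq_integral) auto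
    also have "(\<integral>t. ((d p t)\<^sup>2 / ?q + ?q) / 2 \<partial>M)
        = ((\<integral>t. (d p t)\<^sup>2 \<partial>M) / ?q + ?q * measure M (space M)) / 2"
      using d_int(1)[of p] by simp
    also have "\<dots> \<le> (8 * (1/4)^p / ?q + ?q * measure M (space M)) / 2"
      using d_int(2)[of p] by (intro divide_right_mono add_right_mono) auto
    also have "\<dots> = ?q * ?K"
    proof -
      have "(1/4::real)^p = ?q * ?q" by (simp flip: power_mult_distrib)
      then show ?thesis by (simp add: field_simps)
    qed
    finally show ?thesis by (simp add: ennreal_leI)
  qed
  have "(\<integral>\<^sup>+t. (\<Sum>p. ennreal \<bar>d p t\<bar>) \<partial>M) = (\<Sum>p. \<integral>\<^sup>+t. ennreal \<bar>d p t\<bar> \<partial>M)"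
    by (rule nn_integral_suminf) simp
  also have "\<dots> \<le> (\<Sum>p. ennreal ((1/2)^p * ?K))"
    by (intro suminf_le d1) auto
  also have "\<dots> = ennreal (\<Sum>p. (1/2)^p * ?K)"
    by (intro suminf_ennreal2) (auto intro!: summable_mult2 summable_geometric)
  also have "\<dots> < \<infinity>" by simp
  finally have "AE t in M. (\<Sum>p. ennreal \<bar>d p t\<bar>) \<noteq> \<infinity>"
    by (intro nn_integral_PInf_AE) auto
  then have "AE t in M. convergent (\<lambda>j. T (w j) t)"
  proof eventually_elim
    case (elim t)
    have "summable (\<lambda>p. \<bar>d p t\<bar>)"
      by (rule summable_suminf_not_top) (use elim in auto)
    then have "summable (\<lambda>p. d p t)" by (rule summable_rabs_cancel)
    then have "convergent (\<lambda>n. \<Sum>p<n. d p t)" by (simp add: summable_iff_convergent)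
    then have "convergent (\<lambda>n. u (w n) t - u (w 0) t)"
      unfolding d_def sum_lessThan_telescope[of "\<lambda>n. u (w n) t"] .
    then have "convergent (\<lambda>n. G t * (u (w n) t - u (w 0) t) + T (w 0) t)"
      by (intro convergent_add convergent_mult convergent_const)
    moreover have "G t * (u (w n) t - u (w 0) t) + T (w 0) t = T (w n) t" for n
      using G1[of t] by (simp add: u_def field_simps)
    ultimately show ?case by simp
  qed
  moreover have "w j \<in> convex hull (z ` {j..})" for j
    using wC[of j] C_mono[OF I_p[of j]] by (auto simp: C_def)
  ultimately show ?thesis using that by blast
qed

section \<open>Setwise convergent measures and integrals\<close>

text \<open>
  The form in which approximation arguments are used below: for each \<open>\<epsilon>\<close> the sequence and its
  prospective limit are replaced by a convergent pair within \<open>\<epsilon>\<close>.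
\<close>

lemma tendsto_if_approximable:
  fixes a :: "nat \<Rightarrow> real"
  assumes "\<And>\<epsilon>. \<epsilon> > 0 \<Longrightarrow> \<exists>b b'. b \<longlonglongrightarrow> b' \<and> \<bar>a' - b'\<bar> \<le> \<epsilon> \<and> (\<forall>\<^sub>F n in sequentially. \<bar>a n - b n\<bar> \<le> \<epsilon>)"
  shows "a \<longlonglongrightarrow> a'"
proof (rule tendstoI)
  fix e :: real assume "e > 0"
  then obtain b b' where b: "b \<longlonglongrightarrow> b'" "\<bar>a' - b'\<bar> \<le> e / 4"
    "\<forall>\<^sub>F n in sequentially. \<bar>a n - b n\<bar> \<le> e / 4"
    using assms[of "e / 4"] by auto
  have "\<forall>\<^sub>F n in sequentially. dist (b n) b' < e / 4"
    using b(1) \<open>e > 0\<close> by (intro tendstoD) auto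
  with b(3) show "\<forall>\<^sub>F n in sequentially. dist (a n) a' < e"
  proof eventually_elim
    case (elim n)
    then show ?case using b(2) \<open>e > 0\<close> unfolding dist_real_def by linarith
  qed
qed

lemma floor_as_level_count:
  fixes x :: real
  assumes "0 \<le> x" "x \<le> real N"
  shows "\<bar>x - (\<Sum>i\<in>{1..N}. if real i \<le> x then 1 else 0)\<bar> \<le> 1"
proof -
  have "(\<Sum>i\<in>{1..N}. if real i \<le> x then 1 else (0::real)) = real (card {i \<in> {1..N}. real i \<le> x})"
    by (subst sum.inter_filter[symmetric]) auto
  also have "{i \<in> {1..N}. real i \<le> x} = {1..nat \<lfloor>x\<rfloor>}"
    using assms by (auto simp: le_nat_floor) (linarith)+
  finally show ?thesis using assms(1) by simp linarith
qed

lemma (in finite_measure) measure_large_values_small: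
  fixes \<phi> :: "'a \<Rightarrow> real"
  assumes [measurable]: "\<phi> \<in> borel_measurable M" and "\<delta> > 0"
  obtains k :: nat where "measure M {t \<in> space M. real k < \<bar>\<phi> t\<bar>} < \<delta>"
proof -
  define B where "B k = {t \<in> space M. real k < \<bar>\<phi> t\<bar>}" for k :: nat
  have "(\<lambda>k. measure M (B k)) \<longlonglongrightarrow> measure M (\<Inter>k. B k)"
    by (rule finite_Lim_measure_decseq) (auto simp: B_def decseq_def)
  moreover have "(\<Inter>k. B k) = {}"
  proof (rule ccontr)
    assume "(\<Inter>k. B k) \<noteq> {}"
    then obtain t where t: "\<And>k. t \<in> B k" by blast
    obtain k :: nat where "\<bar>\<phi> t\<bar> \<le> real k" using real_arch_simple by blast
    then show False using t[of k] by (simp add: B_def)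
  qed
  ultimately have "\<forall>\<^sub>F k in sequentially. measure M (B k) < \<delta>"
    using \<open>\<delta> > 0\<close> by (intro order_tendstoD(2)) auto
  then obtain k where "measure M (B k) < \<delta>" by (metis eventually_happens sequentially_bot)
  then show ?thesis using that by (simp add: B_def)
qed

text \<open>
  The integrals are taken in \<^typ>\<open>ennreal\<close> so that the bound is meaningful before integrability of the
  integrands is known.
\<close>

definition uniformly_ac_integrals :: "(nat \<Rightarrow> 'a measure) \<Rightarrow> (nat \<Rightarrow> 'a \<Rightarrow> real) \<Rightarrow> bool" where
  "uniformly_ac_integrals ms \<phi>s \<longleftrightarrow> (\<forall>\<epsilon>::real>0. \<exists>\<delta>::real>0. \<forall>n. \<forall>A\<in>sets (ms n).
     measure (ms n) A < \<delta> \<longrightarrow> (\<integral>\<^sup>+t\<in>A. ennreal \<bar>\<phi>s n t\<bar> \<partial>ms n) \<le> ennreal \<epsilon>)"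

locale setwise_convergence =
  fixes m :: "'a measure" and ms :: "nat \<Rightarrow> 'a measure"
  assumes finite_limit: "finite_measure m"
    and finite_seq: "\<And>n. finite_measure (ms n)"
    and sets_seq [measurable_cong, simp]: "\<And>n. sets (ms n) = sets m"
    and setwise: "\<And>A. A \<in> sets m \<Longrightarrow> (\<lambda>n. measure (ms n) A) \<longlonglongrightarrow> measure m A"
begin

lemma space_seq [simp]: "space (ms n) = space m"
  by (rule sets_eq_imp_space_eq) simp

lemma total_mass_eventually_bounded:
  "\<forall>\<^sub>F n in sequentially. measure (ms n) (space m) \<le> measure m (space m) + 1"
proof -
  have "\<forall>\<^sub>F n in sequentially. measure (ms n) (space m) < measure m (space m) + 1"
    by (rule order_tendstoD(2)[OF setwise]) auto
  then show ?thesis by eventually_elim simp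
qed

text \<open>
  Rounding \<open>N * \<phi>\<close> down to an integer counts the levels \<open>i \<le> N\<close> with \<open>i \<le> N * \<phi> t\<close>, so \<open>\<phi>\<close> is uniformly
  within \<open>1 / N\<close> of an average of indicators of level sets, for which convergence of the integrals is
  setwise convergence. The total masses are eventually bounded, so the error is uniform in \<open>n\<close>.
\<close>

lemma tendsto_integral_unit_interval:
  fixes \<phi> :: "'a \<Rightarrow> real"
  assumes [measurable]: "\<phi> \<in> borel_measurable m" and "\<And>t. 0 \<le> \<phi> t" "\<And>t. \<phi> t \<le> 1"
  shows "(\<lambda>n. \<integral>t. \<phi> t \<partial>ms n) \<longlonglongrightarrow> (\<integral>t. \<phi> t \<partial>m)"
proof (rule tendsto_if_approximable)
  fix \<epsilon> :: real assume "\<epsilon> > 0"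
  define K where "K = measure m (space m) + 1"
  have "K > 0" by (simp add: K_def add_nonneg_pos)
  obtain N :: nat where "K / \<epsilon> < real N" using reals_Archimedean2 by blast
  moreover have "K / \<epsilon> > 0" using \<open>K > 0\<close> \<open>\<epsilon> > 0\<close> by simp
  ultimately have "real N > 0" by linarith
  then have "N > 0" by simp
  have KN: "K / N \<le> \<epsilon>"
    using \<open>K / \<epsilon> < real N\<close> \<open>N > 0\<close> \<open>\<epsilon> > 0\<close> by (simp add: field_simps)
  define lev where "lev i = {t \<in> space m. real i \<le> N * \<phi> t}" for i
  have [measurable]: "lev i \<in> sets m" for i unfolding lev_def by measurable
  define \<psi> where "\<psi> t = (\<Sum>i\<in>{1..N}. indicator (lev i) t) / N" for t
  have near: "\<bar>\<phi> t - \<psi> t\<bar> \<le> 1 / N" if "t \<in> space m" for t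
  proof -
    have "\<bar>N * \<phi> t - (\<Sum>i\<in>{1..N}. if real i \<le> N * \<phi> t then 1 else 0)\<bar> \<le> 1"
      using assms(2)[of t] assms(3)[of t] by (intro floor_as_level_count) (auto simp: mult_left_le)
    also have "(\<Sum>i\<in>{1..N}. if real i \<le> N * \<phi> t then 1 else (0::real)) = (\<Sum>i\<in>{1..N}. indicator (lev i) t)"
      using that by (intro sum.cong) (auto simp: lev_def)
    also have "\<dots> = N * \<psi> t" using \<open>N > 0\<close> by (simp add: \<psi>_def)
    also have "N * \<phi> t - N * \<psi> t = N * (\<phi> t - \<psi> t)" by (rule right_diff_distrib[symmetric])
    finally have "N * \<bar>\<phi> t - \<psi> t\<bar> \<le> 1" by (simp only: abs_mult abs_of_nat)
    then show ?thesis using \<open>N > 0\<close> by (simp add: field_simps)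
  qed
  have close: "\<bar>(\<integral>t. \<phi> t \<partial>\<mu>) - (\<integral>t. \<psi> t \<partial>\<mu>)\<bar> \<le> measure \<mu> (space m) / N"
    and \<psi>_int: "(\<integral>t. \<psi> t \<partial>\<mu>) = (\<Sum>i\<in>{1..N}. measure \<mu> (lev i)) / N"
    if "finite_measure \<mu>" and sets: "sets \<mu> = sets m" for \<mu>
  proof -
    interpret \<mu>: finite_measure \<mu> by fact
    note [measurable_cong] = sets
    have [simp]: "space \<mu> = space m" using sets by (rule sets_eq_imp_space_eq)
    have int_ind: "integrable \<mu> (indicator (lev i) :: _ \<Rightarrow> real)" for i
      by (intro \<mu>.integrable_const_bound[where B = 1]) auto
    have int_\<psi>: "integrable \<mu> \<psi>" unfolding \<psi>_def using int_ind by auto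
    have int_\<phi>: "integrable \<mu> \<phi>"
      using assms(2,3) by (intro \<mu>.integrable_const_bound[where B = 1]) auto
    have "\<bar>\<integral>t. \<phi> t - \<psi> t \<partial>\<mu>\<bar> \<le> (\<integral>t. \<bar>\<phi> t - \<psi> t\<bar> \<partial>\<mu>)" by (rule integral_abs_bound)
    also have "\<dots> \<le> (\<integral>t. 1 / N \<partial>\<mu>)"
      using int_\<phi> int_\<psi> near by (intro integral_mono) auto
    finally show "\<bar>(\<integral>t. \<phi> t \<partial>\<mu>) - (\<integral>t. \<psi> t \<partial>\<mu>)\<bar> \<le> measure \<mu> (space m) / N"
      using int_\<phi> int_\<psi> by simp
    show "(\<integral>t. \<psi> t \<partial>\<mu>) = (\<Sum>i\<in>{1..N}. measure \<mu> (lev i)) / N"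
      unfolding \<psi>_def using int_ind by (simp add: sets)
  qed
  show "\<exists>b b'. b \<longlonglongrightarrow> b' \<and> \<bar>(\<integral>t. \<phi> t \<partial>m) - b'\<bar> \<le> \<epsilon> \<and>
      (\<forall>\<^sub>F n in sequentially. \<bar>(\<integral>t. \<phi> t \<partial>ms n) - b n\<bar> \<le> \<epsilon>)"
  proof (intro exI conjI)
    show "(\<lambda>n. \<integral>t. \<psi> t \<partial>ms n) \<longlonglongrightarrow> (\<integral>t. \<psi> t \<partial>m)"
      unfolding \<psi>_int[OF finite_seq sets_seq] \<psi>_int[OF finite_limit refl]
      using \<open>N > 0\<close> by (intro tendsto_intros setwise) auto
    have "measure m (space m) / N \<le> K / N" by (intro divide_right_mono) (auto simp: K_def)
    then show "\<bar>(\<integral>t. \<phi> t \<partial>m) - (\<integral>t. \<psi> t \<partial>m)\<bar> \<le> \<epsilon>"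
      using close[OF finite_limit refl] KN by linarith
    show "\<forall>\<^sub>F n in sequentially. \<bar>(\<integral>t. \<phi> t \<partial>ms n) - (\<integral>t. \<psi> t \<partial>ms n)\<bar> \<le> \<epsilon>"
      using total_mass_eventually_bounded
    proof eventually_elim
      case (elim n)
      then have "measure (ms n) (space m) / N \<le> K / N" by (intro divide_right_mono) (auto simp: K_def)
      then show ?case using close[OF finite_seq sets_seq, of n] KN by linarith
    qed
  qed
qed

lemma tendsto_integral_bounded:
  fixes \<phi> :: "'a \<Rightarrow> real"
  assumes [measurable]: "\<phi> \<in> borel_measurable m" and bnd: "\<And>t. \<bar>\<phi> t\<bar> \<le> C"
  shows "(\<lambda>n. \<integral>t. \<phi> t \<partial>ms n) \<longlonglongrightarrow> (\<integral>t. \<phi> t \<partial>m)"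
proof -
  define D where "D = C + 1"
  have "C \<ge> 0" using bnd[of undefined] by linarith
  then have "D > 0" by (simp add: D_def)
  have bndD: "\<bar>\<phi> t\<bar> \<le> D" for t using bnd[of t] by (simp add: D_def)
  define \<psi> where "\<psi> t = (\<phi> t + D) / (2 * D)" for t
  have [measurable]: "\<psi> \<in> borel_measurable m" unfolding \<psi>_def by measurable
  have \<psi>01: "0 \<le> \<psi> t" "\<psi> t \<le> 1" for t
    using bndD[of t] \<open>D > 0\<close> by (auto simp: \<psi>_def abs_le_iff field_simps)
  have eq: "(\<integral>t. \<phi> t \<partial>\<mu>) = 2 * D * (\<integral>t. \<psi> t \<partial>\<mu>) - D * measure \<mu> (space m)"
    if "finite_measure \<mu>" and sets: "sets \<mu> = sets m" for \<mu>
  proof -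
    interpret \<mu>: finite_measure \<mu> by fact
    note [measurable_cong] = sets
    have "integrable \<mu> \<psi>"
      using \<psi>01 by (intro \<mu>.integrable_const_bound[where B = 1]) auto
    then have "(\<integral>t. 2 * D * \<psi> t - D \<partial>\<mu>) = 2 * D * (\<integral>t. \<psi> t \<partial>\<mu>) - D * measure \<mu> (space m)"
      using sets_eq_imp_space_eq[OF sets] by simp
    moreover have "\<phi> t = 2 * D * \<psi> t - D" for t using \<open>D > 0\<close> by (simp add: \<psi>_def)
    ultimately show ?thesis by simp
  qed
  show ?thesis
    unfolding eq[OF finite_seq sets_seq] eq[OF finite_limit refl]
    by (intro tendsto_intros tendsto_integral_unit_interval setwise \<psi>01) auto
qed

text \<open>
  A Fatou lemma for varying measures: truncations of \<open>\<phi>\<close> are bounded, so their integrals converge and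
  inherit the bound, which survives the removal of the truncation by the usual Fatou lemma.
\<close>

lemma nn_integral_le_if_eventually_le:
  assumes [measurable]: "\<phi> \<in> borel_measurable m" "A \<in> sets m" and "c \<ge> 0"
    and le: "\<forall>\<^sub>F n in sequentially. (\<integral>\<^sup>+t\<in>A. ennreal \<bar>\<phi> t\<bar> \<partial>ms n) \<le> ennreal c"
  shows "(\<integral>\<^sup>+t\<in>A. ennreal \<bar>\<phi> t\<bar> \<partial>m) \<le> ennreal c"
proof -
  define \<psi> where "\<psi> k t = min \<bar>\<phi> t\<bar> (real k) * indicator A t" for k :: nat and t
  have [measurable]: "\<psi> k \<in> borel_measurable m" for k unfolding \<psi>_def by measurable
  have \<psi>0: "\<psi> k t \<ge> 0" and \<psi>k: "\<psi> k t \<le> real k" for k t by (auto simp: \<psi>_def indicator_def)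
  have fin: "integrable \<mu> (\<psi> k)" if "finite_measure \<mu>" "sets \<mu> = sets m" for \<mu> k
  proof -
    interpret \<mu>: finite_measure \<mu> by fact
    note [measurable_cong] = that(2)
    show ?thesis using \<psi>0 \<psi>k by (intro \<mu>.integrable_const_bound[where B = "real k"]) auto
  qed
  have trunc: "(\<integral>\<^sup>+t. ennreal (\<psi> k t) \<partial>m) \<le> ennreal c" for k
  proof -
    have "(\<lambda>n. \<integral>t. \<psi> k t \<partial>ms n) \<longlonglongrightarrow> (\<integral>t. \<psi> k t \<partial>m)"
      using \<psi>0 \<psi>k by (intro tendsto_integral_bounded[where C = "real k"]) auto
    moreover have "\<forall>\<^sub>F n in sequentially. (\<integral>t. \<psi> k t \<partial>ms n) \<le> c"
      using le
    proof eventually_elim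
      case (elim n)
      have "ennreal (\<integral>t. \<psi> k t \<partial>ms n) = (\<integral>\<^sup>+t. ennreal (\<psi> k t) \<partial>ms n)"
        using fin[OF finite_seq sets_seq] \<psi>0 by (intro nn_integral_eq_integral[symmetric]) auto
      also have "\<dots> \<le> (\<integral>\<^sup>+t\<in>A. ennreal \<bar>\<phi> t\<bar> \<partial>ms n)"
        by (intro nn_integral_mono) (auto simp: \<psi>_def indicator_def intro!: ennreal_leI)
      also note elim
      finally show ?case using \<open>c \<ge> 0\<close> by (simp add: ennreal_le_iff)
    qed
    ultimately have "(\<integral>t. \<psi> k t \<partial>m) \<le> c" by (intro tendsto_upperbound) auto
    moreover have "(\<integral>\<^sup>+t. ennreal (\<psi> k t) \<partial>m) = ennreal (\<integral>t. \<psi> k t \<partial>m)"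
      using fin[OF finite_limit refl] \<psi>0 by (intro nn_integral_eq_integral) auto
    ultimately show ?thesis by (simp add: ennreal_leI)
  qed
  have "ennreal \<bar>\<phi> t\<bar> * indicator A t = liminf (\<lambda>k. ennreal (\<psi> k t))" for t
  proof (rule lim_imp_Liminf[symmetric])
    obtain k0 :: nat where "\<bar>\<phi> t\<bar> \<le> real k0" using real_arch_simple by blast
    have "\<forall>\<^sub>F k in sequentially. ennreal (\<psi> k t) = ennreal \<bar>\<phi> t\<bar> * indicator A t"
      using eventually_ge_at_top[of k0]
    proof eventually_elim
      case (elim k)
      then have "\<bar>\<phi> t\<bar> \<le> real k" using \<open>\<bar>\<phi> t\<bar> \<le> real k0\<close> by simp
      then show ?case by (simp add: \<psi>_def indicator_def)
    qed
    then show "(\<lambda>k. ennreal (\<psi> k t)) \<longlonglongrightarrow> ennreal \<bar>\<phi> t\<bar> * indicator A t"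
      by (rule tendsto_eventually)
  qed simp
  then have "(\<integral>\<^sup>+t\<in>A. ennreal \<bar>\<phi> t\<bar> \<partial>m) = (\<integral>\<^sup>+t. liminf (\<lambda>k. ennreal (\<psi> k t)) \<partial>m)"
    by simp
  also have "\<dots> \<le> liminf (\<lambda>k. \<integral>\<^sup>+t. ennreal (\<psi> k t) \<partial>m)"
    by (rule nn_integral_liminf) simp
  also have "\<dots> \<le> liminf (\<lambda>k. ennreal c)"
    by (intro Liminf_mono always_eventually allI trunc)
  finally show ?thesis by (simp add: Liminf_const)
qed

text \<open>
  The point is that the same \<open>\<delta>\<close> serves for the limit measure. Hence a \<open>\<delta>\<close> that is uniform over a family
  of integrands, such as the scalarizations by the dual unit ball, remains uniform in the limit.
\<close>

lemma limit_inherits_absolute_continuity: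
  assumes "\<phi> \<in> borel_measurable m" "c \<ge> 0"
    and "\<And>n A. A \<in> sets m \<Longrightarrow> measure (ms n) A < \<delta> \<Longrightarrow> (\<integral>\<^sup>+t\<in>A. ennreal \<bar>\<phi> t\<bar> \<partial>ms n) \<le> ennreal c"
    and "A \<in> sets m" "measure m A < \<delta>"
  shows "(\<integral>\<^sup>+t\<in>A. ennreal \<bar>\<phi> t\<bar> \<partial>m) \<le> ennreal c"
proof (rule nn_integral_le_if_eventually_le)
  have "\<forall>\<^sub>F n in sequentially. measure (ms n) A < \<delta>"
    using assms(4,5) by (intro order_tendstoD(2)[OF setwise])
  then show "\<forall>\<^sub>F n in sequentially. (\<integral>\<^sup>+t\<in>A. ennreal \<bar>\<phi> t\<bar> \<partial>ms n) \<le> ennreal c"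
    by eventually_elim (rule assms(3)[OF assms(4)])
qed (use assms(1,2,4) in auto)

text \<open>
  Off a set of small measure \<open>\<phi>\<close> is bounded, and on that set its integral is controlled.
\<close>

lemma uniformly_ac_imp_limit_integrable:
  assumes [measurable]: "\<phi> \<in> borel_measurable m" and ac: "uniformly_ac_integrals ms (\<lambda>_. \<phi>)"
  shows "integrable m \<phi>"
proof -
  interpret finite_measure m by (rule finite_limit)
  obtain \<delta> :: real where "\<delta> > 0" and \<delta>: "\<And>n A. A \<in> sets m \<Longrightarrow> measure (ms n) A < \<delta> \<Longrightarrow>
      (\<integral>\<^sup>+t\<in>A. ennreal \<bar>\<phi> t\<bar> \<partial>ms n) \<le> ennreal 1"
    using ac[unfolded uniformly_ac_integrals_def, rule_format, of 1] by auto
  obtain k :: nat where k: "measure m {t \<in> space m. real k < \<bar>\<phi> t\<bar>} < \<delta>" (is "measure m ?B < _")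
    using measure_large_values_small[OF assms(1) \<open>\<delta> > 0\<close>] .
  have "(\<integral>\<^sup>+t. ennreal \<bar>\<phi> t\<bar> \<partial>m) \<le> (\<integral>\<^sup>+t. ennreal k + ennreal \<bar>\<phi> t\<bar> * indicator ?B t \<partial>m)"
    by (intro nn_integral_mono) (auto simp: indicator_def intro: ennreal_leI)
  also have "\<dots> = ennreal k * emeasure m (space m) + (\<integral>\<^sup>+t\<in>?B. ennreal \<bar>\<phi> t\<bar> \<partial>m)"
    by (subst nn_integral_add) auto
  also have "\<dots> \<le> ennreal k * emeasure m (space m) + ennreal 1"
    by (intro add_left_mono limit_inherits_absolute_continuity[OF _ _ \<delta>]) (use k in auto)
  also have "\<dots> < \<infinity>"
    by (simp add: ennreal_mult_less_top emeasure_eq_measure)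
  finally show ?thesis by (simp add: integrable_iff_bounded)
qed

text \<open>
  Truncate at a height \<open>k\<close> that \<open>\<phi>\<close> exceeds only on a set \<open>B\<close> with \<open>m\<close>-measure below \<open>\<delta>\<close>. By setwise
  convergence the same holds for \<open>ms n\<close> with \<open>n\<close> large, so the truncation error is at most \<open>\<epsilon>\<close> for all
  these measures.
\<close>

lemma tendsto_set_integral_fixed_integrand:
  assumes [measurable]: "\<phi> \<in> borel_measurable m" "A \<in> sets m"
    and int: "\<And>n. integrable (ms n) \<phi>" and ac: "uniformly_ac_integrals ms (\<lambda>_. \<phi>)"
  shows "(\<lambda>n. LINT t:A|ms n. \<phi> t) \<longlonglongrightarrow> (LINT t:A|m. \<phi> t)"
proof (rule tendsto_if_approximable)
  fix \<epsilon> :: real assume "\<epsilon> > 0"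
  interpret finite_measure m by (rule finite_limit)
  obtain \<delta> :: real where "\<delta> > 0" and \<delta>: "\<And>n A. A \<in> sets m \<Longrightarrow> measure (ms n) A < \<delta> \<Longrightarrow>
      (\<integral>\<^sup>+t\<in>A. ennreal \<bar>\<phi> t\<bar> \<partial>ms n) \<le> ennreal \<epsilon>"
    using ac[unfolded uniformly_ac_integrals_def, rule_format, OF \<open>\<epsilon> > 0\<close>] by auto
  obtain k :: nat where k: "measure m {t \<in> space m. real k < \<bar>\<phi> t\<bar>} < \<delta>"
    using measure_large_values_small[OF assms(1) \<open>\<delta> > 0\<close>] .
  define B where "B = {t \<in> space m. real k < \<bar>\<phi> t\<bar>}"
  have [measurable]: "B \<in> sets m" unfolding B_def by measurable
  define \<psi> where "\<psi> t = (if real k < \<bar>\<phi> t\<bar> then 0 else indicator A t * \<phi> t)" for t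
  have [measurable]: "\<psi> \<in> borel_measurable m" unfolding \<psi>_def by measurable
  have \<psi>k: "\<bar>\<psi> t\<bar> \<le> real k" for t by (auto simp: \<psi>_def indicator_def)
  have close: "\<bar>(LINT t:A|\<mu>. \<phi> t) - (\<integral>t. \<psi> t \<partial>\<mu>)\<bar> \<le> \<epsilon>"
    if "finite_measure \<mu>" and sets: "sets \<mu> = sets m" and "integrable \<mu> \<phi>"
      and small: "(\<integral>\<^sup>+t\<in>B. ennreal \<bar>\<phi> t\<bar> \<partial>\<mu>) \<le> ennreal \<epsilon>" for \<mu>
  proof -
    interpret \<mu>: finite_measure \<mu> by fact
    note [measurable_cong] = sets
    have int_\<psi>: "integrable \<mu> \<psi>"
      using \<psi>k by (intro \<mu>.integrable_const_bound[where B = "real k"]) auto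
    have int_A: "integrable \<mu> (\<lambda>t. indicator A t *\<^sub>R \<phi> t)"
      using \<open>integrable \<mu> \<phi>\<close> by (intro integrable_mult_indicator) auto
    have "ennreal \<bar>(LINT t:A|\<mu>. \<phi> t) - (\<integral>t. \<psi> t \<partial>\<mu>)\<bar>
        = ennreal (norm (\<integral>t. indicator A t *\<^sub>R \<phi> t - \<psi> t \<partial>\<mu>))"
      using int_\<psi> int_A by (simp add: set_lebesgue_integral_def)
    also have "\<dots> \<le> (\<integral>\<^sup>+t. ennreal (norm (indicator A t *\<^sub>R \<phi> t - \<psi> t)) \<partial>\<mu>)"
      using int_\<psi> int_A by (intro integral_norm_bound_ennreal) auto
    also have "\<dots> \<le> (\<integral>\<^sup>+t\<in>B. ennreal \<bar>\<phi> t\<bar> \<partial>\<mu>)"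
      using sets_eq_imp_space_eq[OF sets]
      by (intro nn_integral_mono) (auto simp: \<psi>_def B_def indicator_def)
    also note small
    finally show ?thesis using \<open>\<epsilon> > 0\<close> by (simp add: ennreal_le_iff)
  qed
  show "\<exists>b b'. b \<longlonglongrightarrow> b' \<and> \<bar>(LINT t:A|m. \<phi> t) - b'\<bar> \<le> \<epsilon> \<and>
      (\<forall>\<^sub>F n in sequentially. \<bar>(LINT t:A|ms n. \<phi> t) - b n\<bar> \<le> \<epsilon>)"
  proof (intro exI conjI)
    show "(\<lambda>n. \<integral>t. \<psi> t \<partial>ms n) \<longlonglongrightarrow> (\<integral>t. \<psi> t \<partial>m)"
      by (rule tendsto_integral_bounded[OF _ \<psi>k]) simp
    show "\<bar>(LINT t:A|m. \<phi> t) - (\<integral>t. \<psi> t \<partial>m)\<bar> \<le> \<epsilon>"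
      using k \<open>\<epsilon> > 0\<close>
      by (intro close finite_limit uniformly_ac_imp_limit_integrable ac
          limit_inherits_absolute_continuity[OF _ _ \<delta>]) (auto simp: B_def)
    have "\<forall>\<^sub>F n in sequentially. measure (ms n) B < \<delta>"
      using k by (intro order_tendstoD(2)[OF setwise]) (auto simp: B_def)
    then show "\<forall>\<^sub>F n in sequentially. \<bar>(LINT t:A|ms n. \<phi> t) - (\<integral>t. \<psi> t \<partial>ms n)\<bar> \<le> \<epsilon>"
      by eventually_elim (intro close finite_seq sets_seq int \<delta>; simp)
  qed
qed

text \<open>
  Almost everywhere convergence makes the sets \<open>B n\<close> where \<open>\<phi>s n\<close> and \<open>\<phi>\<close> differ by more than \<open>\<eta>\<close> small
  for \<open>m\<close>, and therefore for all \<open>ms n\<close> at once. Off \<open>B n\<close> the integrands are \<open>\<eta>\<close>-close, on \<open>B n\<close> both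
  integrals are small; what remains is the convergence for the fixed integrand \<open>\<phi>\<close>. For the constant
  sequence \<open>ms n = m\<close> this is the classical Vitali theorem, and it is used in that form too.
\<close>

theorem vitali_convergence_varying_measures:
  assumes [measurable]: "A \<in> sets m" "\<phi> \<in> borel_measurable m" "\<And>n. \<phi>s n \<in> borel_measurable m"
    and int: "\<And>n. integrable (ms n) \<phi>" "\<And>n. integrable (ms n) (\<phi>s n)"
    and ac: "uniformly_ac_integrals ms (\<lambda>_. \<phi>)" "uniformly_ac_integrals ms \<phi>s"
    and uac: "\<And>\<epsilon>. \<epsilon> > 0 \<Longrightarrow> \<exists>\<delta>>0. \<forall>E\<in>sets m. measure m E < \<delta> \<longrightarrow> (\<forall>n. measure (ms n) E < \<epsilon>)"
    and lim: "AE t in m. (\<lambda>n. \<phi>s n t) \<longlonglongrightarrow> \<phi> t"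
  shows "(\<lambda>n. LINT t:A|ms n. \<phi>s n t) \<longlonglongrightarrow> (LINT t:A|m. \<phi> t)"
proof (rule tendsto_if_approximable)
  fix \<epsilon> :: real assume "\<epsilon> > 0"
  interpret finite_measure m by (rule finite_limit)
  define K where "K = measure m (space m) + 1"
  have "K > 0" by (simp add: K_def add_nonneg_pos)
  define \<eta> where "\<eta> = \<epsilon> / (3 * K)"
  have "\<eta> > 0" using \<open>K > 0\<close> \<open>\<epsilon> > 0\<close> by (simp add: \<eta>_def)
  have "\<epsilon> / 3 > 0" using \<open>\<epsilon> > 0\<close> by simp
  obtain \<delta>1 :: real where "\<delta>1 > 0" and \<delta>1: "\<And>n A. A \<in> sets m \<Longrightarrow> measure (ms n) A < \<delta>1 \<Longrightarrow>
      (\<integral>\<^sup>+t\<in>A. ennreal \<bar>\<phi> t\<bar> \<partial>ms n) \<le> ennreal (\<epsilon> / 3)"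
    using ac(1)[unfolded uniformly_ac_integrals_def, rule_format, OF \<open>\<epsilon> / 3 > 0\<close>] by auto
  obtain \<delta>2 :: real where "\<delta>2 > 0" and \<delta>2: "\<And>n A. A \<in> sets m \<Longrightarrow> measure (ms n) A < \<delta>2 \<Longrightarrow>
      (\<integral>\<^sup>+t\<in>A. ennreal \<bar>\<phi>s n t\<bar> \<partial>ms n) \<le> ennreal (\<epsilon> / 3)"
    using ac(2)[unfolded uniformly_ac_integrals_def, rule_format, OF \<open>\<epsilon> / 3 > 0\<close>] by auto
  have "min \<delta>1 \<delta>2 > 0" using \<open>\<delta>1 > 0\<close> \<open>\<delta>2 > 0\<close> by simp
  from uac[OF this] obtain \<delta> where "\<delta> > 0"
    and \<delta>: "\<And>E n. E \<in> sets m \<Longrightarrow> measure m E < \<delta> \<Longrightarrow> measure (ms n) E < min \<delta>1 \<delta>2"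
    by blast
  define B where "B n = {t \<in> space m. \<eta> < \<bar>\<phi>s n t - \<phi> t\<bar>}" for n
  have [measurable]: "B n \<in> sets m" for n unfolding B_def by measurable
  have "(\<lambda>n. \<integral>t. indicator (B n) t \<partial>m) \<longlonglongrightarrow> (\<integral>t. (0::real) \<partial>m)"
  proof (rule integral_dominated_convergence[where w = "\<lambda>_. 1"])
    show "AE t in m. (\<lambda>n. indicator (B n) t) \<longlonglongrightarrow> (0::real)"
      using lim
    proof eventually_elim
      case (elim t)
      have "\<forall>\<^sub>F n in sequentially. dist (\<phi>s n t) (\<phi> t) < \<eta>" using elim \<open>\<eta> > 0\<close> by (rule tendstoD)
      then have "\<forall>\<^sub>F n in sequentially. indicator (B n) t = (0::real)"
        by eventually_elim (auto simp: B_def dist_real_def)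
      then show ?case by (rule tendsto_eventually)
    qed
  qed auto
  then have "(\<lambda>n. measure m (B n)) \<longlonglongrightarrow> 0" by simp
  then have "\<forall>\<^sub>F n in sequentially. measure m (B n) < \<delta>"
    using \<open>\<delta> > 0\<close> by (rule order_tendstoD)
  then have close: "\<forall>\<^sub>F n in sequentially. \<bar>(LINT t:A|ms n. \<phi>s n t) - (LINT t:A|ms n. \<phi> t)\<bar> \<le> \<epsilon>"
    using total_mass_eventually_bounded
  proof eventually_elim
    case (elim n)
    interpret n: finite_measure "ms n" by (rule finite_seq)
    have intA: "integrable (ms n) (\<lambda>t. indicator A t *\<^sub>R \<phi> t)"
      "integrable (ms n) (\<lambda>t. indicator A t *\<^sub>R \<phi>s n t)"
      by (intro integrable_mult_indicator int; simp)+
    have "ennreal \<bar>(LINT t:A|ms n. \<phi>s n t) - (LINT t:A|ms n. \<phi> t)\<bar>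
        = ennreal (norm (\<integral>t. indicator A t *\<^sub>R \<phi>s n t - indicator A t *\<^sub>R \<phi> t \<partial>ms n))"
      using intA by (simp add: set_lebesgue_integral_def)
    also have "\<dots> \<le> (\<integral>\<^sup>+t. ennreal (norm (indicator A t *\<^sub>R \<phi>s n t - indicator A t *\<^sub>R \<phi> t)) \<partial>ms n)"
      using intA by (intro integral_norm_bound_ennreal) auto
    also have "\<dots> \<le> (\<integral>\<^sup>+t. ennreal \<eta> + (ennreal \<bar>\<phi>s n t\<bar> * indicator (B n) t
        + ennreal \<bar>\<phi> t\<bar> * indicator (B n) t) \<partial>ms n)"
      using \<open>\<eta> > 0\<close>
      by (intro nn_integral_mono)
        (auto simp: B_def indicator_def not_less simp flip: ennreal_plus intro!: ennreal_leI)
    also have "\<dots> = ennreal \<eta> * emeasure (ms n) (space m)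
        + ((\<integral>\<^sup>+t\<in>B n. ennreal \<bar>\<phi>s n t\<bar> \<partial>ms n) + (\<integral>\<^sup>+t\<in>B n. ennreal \<bar>\<phi> t\<bar> \<partial>ms n))"
      by (simp add: nn_integral_add)
    also have "\<dots> \<le> ennreal (\<epsilon> / 3) + (ennreal (\<epsilon> / 3) + ennreal (\<epsilon> / 3))"
    proof (intro add_mono)
      have "\<eta> * measure (ms n) (space m) \<le> \<eta> * K"
        using elim(2) \<open>\<eta> > 0\<close> by (intro mult_left_mono) (auto simp: K_def)
      also have "\<dots> = \<epsilon> / 3" using \<open>K > 0\<close> by (simp add: \<eta>_def)
      finally show "ennreal \<eta> * emeasure (ms n) (space m) \<le> ennreal (\<epsilon> / 3)"
        using \<open>\<eta> > 0\<close> by (simp add: n.emeasure_eq_measure ennreal_leI flip: ennreal_mult)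
    qed (use \<delta>[OF _ elim(1), of n] in \<open>auto intro!: \<delta>1 \<delta>2\<close>)
    also have "\<dots> = ennreal \<epsilon>" using \<open>\<epsilon> > 0\<close> by (simp flip: ennreal_plus)
    finally show ?case using \<open>\<epsilon> > 0\<close> by (simp add: ennreal_le_iff)
  qed
  show "\<exists>b b'. b \<longlonglongrightarrow> b' \<and> \<bar>(LINT t:A|m. \<phi> t) - b'\<bar> \<le> \<epsilon> \<and>
      (\<forall>\<^sub>F n in sequentially. \<bar>(LINT t:A|ms n. \<phi>s n t) - b n\<bar> \<le> \<epsilon>)"
  proof (intro exI conjI)
    show "(\<lambda>n. LINT t:A|ms n. \<phi> t) \<longlonglongrightarrow> (LINT t:A|m. \<phi> t)"
      using int(1) ac(1) by (intro tendsto_set_integral_fixed_integrand) auto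
  qed (use \<open>\<epsilon> > 0\<close> close in auto)
qed

end

section \<open>From vague to setwise convergence\<close>

text \<open>
  Inner regularity of the complement is outer regularity, because compact sets are closed in a
  Hausdorff space.
\<close>

lemma finite_radon_approximation:
  fixes m :: "'a::t2_space measure"
  assumes "finite_measure m" "sets m = sets borel" "radon_measure m" and "A \<in> sets borel" "\<delta> > 0"
  obtains K U where "compact K" "open U" "K \<subseteq> A" "A \<subseteq> U" "measure m (U - K) < \<delta>"
proof -
  interpret finite_measure m by fact
  have inner: "\<exists>K. compact K \<and> K \<subseteq> B \<and> measure m (B - K) < \<delta> / 2" if B: "B \<in> sets borel" for B
  proof (cases "measure m B = 0")
    case True
    then show ?thesis using \<open>\<delta> > 0\<close> by (intro exI[of _ "{}"]) auto
  next
    case False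
    then have pos: "emeasure m B > 0" by (simp add: emeasure_eq_measure zero_less_measure_iff)
    have "emeasure m B - ennreal (\<delta> / 2) < emeasure m B"
      using pos \<open>\<delta> > 0\<close> by (intro ennreal_between) (auto simp: emeasure_finite less_top[symmetric])
    then obtain K where K: "compact K" "K \<subseteq> B" and less: "emeasure m B - ennreal (\<delta> / 2) < emeasure m K"
      using \<open>radon_measure m\<close> B assms(2) by (auto simp: radon_measure_def less_SUP_iff)
    have Ks: "K \<in> sets m" using K(1) assms(2) by (simp add: borel_compact)
    have "measure m B - \<delta> / 2 < measure m K"
    proof -
      have "ennreal (measure m B - \<delta> / 2) < ennreal (measure m K)"
        using less \<open>\<delta> > 0\<close> by (simp add: emeasure_eq_measure ennreal_minus)
      then show ?thesis by (meson ennreal_leI not_le)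
    qed
    then have "measure m (B - K) < \<delta> / 2"
      using finite_measure_Diff[OF _ Ks K(2)] B assms(2) by simp
    then show ?thesis using K by blast
  qed
  obtain K where K: "compact K" "K \<subseteq> A" "measure m (A - K) < \<delta> / 2"
    using inner[OF \<open>A \<in> sets borel\<close>] by blast
  have "- A \<in> sets borel" using \<open>A \<in> sets borel\<close> by simp
  from inner[OF this] obtain K' where K': "compact K'" "K' \<subseteq> - A" "measure m (- A - K') < \<delta> / 2"
    by blast
  have s: "A - K \<in> sets m" "- A - K' \<in> sets m"
    unfolding assms(2) using borel_compact[OF K(1)] borel_compact[OF K'(1)] \<open>A \<in> sets borel\<close>
    by auto
  have "- K' - K \<subseteq> (A - K) \<union> (- A - K')" by blast
  then have "measure m (- K' - K) \<le> measure m ((A - K) \<union> (- A - K'))"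
    using s by (intro finite_measure_mono) auto
  also have "\<dots> \<le> measure m (A - K) + measure m (- A - K')"
    using s by (rule measure_Un_le)
  finally have "measure m (- K' - K) < \<delta>" using K(3) K'(3) by simp
  moreover have "open (- K')" using K'(1) by (simp add: compact_imp_closed open_Compl)
  ultimately show ?thesis using that[of K "- K'"] K K' by blast
qed

text \<open>
  Complete regularity alone would not make \<open>h\<close> vanish at infinity, so \<open>h\<close> is required to vanish outside
  \<open>U \<inter> V\<close> for an open \<open>V\<close> with compact closure.
\<close>

lemma urysohn_C0_function:
  fixes K U :: "'a::t2_space set"
  assumes lc: "locally_compact_space (euclidean :: 'a topology)"
    and "compact K" "open U" "K \<subseteq> U"
  obtains h where "h \<in> C0_functions" "\<And>t. 0 \<le> h t" "\<And>t. h t \<le> 1"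
    "\<And>t. t \<in> K \<Longrightarrow> h t = 1" "\<And>t. t \<notin> U \<Longrightarrow> h t = 0"
proof -
  have haus: "Hausdorff_space (euclidean :: 'a topology)" by (simp add: Hausdorff_space_def disjnt_def) (meson hausdorff)
  obtain V L where V: "open V" "compact L" "K \<subseteq> V" "V \<subseteq> L"
    using lc \<open>compact K\<close> unfolding locally_compact_space_compact_closed_compact[OF disjI1[OF haus]]
    by (auto simp: compactin_euclidean_iff)
  have creg: "completely_regular_space (euclidean :: 'a topology)"
    using locally_compact_regular_imp_completely_regular_space lc haus by blast
  have "compactin euclidean K" "closedin euclidean (- (U \<inter> V))" "disjnt K (- (U \<inter> V))"
    using V \<open>open U\<close> \<open>K \<subseteq> U\<close> \<open>compact K\<close>
    by (auto simp: disjnt_def compactin_euclidean_iff simp flip: closed_closedin)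
  then obtain f :: "'a \<Rightarrow> real" where f: "continuous_map euclidean (top_of_set {0..1}) f"
    "f ` (- (U \<inter> V)) \<subseteq> {0}" "f ` K \<subseteq> {1}"
    by (rule Urysohn_completely_regular_compact_closed[OF zero_le_one creg])
  have cont: "continuous_on UNIV f" and f01: "\<And>t. f t \<in> {0..1}"
    using f(1) by (auto simp: continuous_map_in_subtopology)
  show ?thesis
  proof
    show "f \<in> C0_functions"
      unfolding C0_functions_def
    proof (intro CollectI conjI allI impI)
      fix \<epsilon> :: real assume "\<epsilon> > 0"
      have "\<bar>f t\<bar> < \<epsilon>" if "t \<notin> L" for t
      proof -
        have "t \<in> - (U \<inter> V)" using that V(4) by blast
        then have "f t = 0" using f(2) by blast
        then show ?thesis using \<open>\<epsilon> > 0\<close> by simp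
      qed
      then show "\<exists>K. compact K \<and> (\<forall>t. t \<notin> K \<longrightarrow> \<bar>f t\<bar> < \<epsilon>)" using V(2) by blast
    qed (intro continuous_intros cont)
  qed (use f f01 in \<open>auto simp: image_subset_iff\<close>)
qed

lemma uniformly_absolutely_continuousD:
  assumes "uniformly_absolutely_continuous ms m" "finite_measure m" "\<And>n. finite_measure (ms n)"
    and "\<epsilon> > 0"
  shows "\<exists>\<delta>>0. \<forall>E\<in>sets m. measure m E < \<delta> \<longrightarrow> (\<forall>n. measure (ms n) E < \<epsilon>)"
proof -
  obtain \<delta> :: real where "\<delta> > 0" and
    \<delta>: "\<forall>E\<in>sets m. emeasure m E < ennreal \<delta> \<longrightarrow> (SUP n. emeasure (ms n) E) < ennreal \<epsilon>"
    using assms(1,4) unfolding uniformly_absolutely_continuous_def by blast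
  have "measure (ms n) E < \<epsilon>" if "E \<in> sets m" "measure m E < \<delta>" for n E
  proof -
    interpret m: finite_measure m by fact
    interpret n: finite_measure "ms n" by fact
    have "emeasure m E < ennreal \<delta>"
      using that(2) \<open>\<delta> > 0\<close> by (simp add: m.emeasure_eq_measure ennreal_lessI)
    then have "(SUP n. emeasure (ms n) E) < ennreal \<epsilon>" using \<delta> that(1) by blast
    then have "emeasure (ms n) E < ennreal \<epsilon>" by (rule le_less_trans[OF SUP_upper, rotated]) simp
    then show ?thesis by (simp add: n.emeasure_eq_measure ennreal_less_iff)
  qed
  then show ?thesis using \<open>\<delta> > 0\<close> by blast
qed

text \<open>
  For \<open>K \<subseteq> A \<subseteq> U\<close> and a Urysohn function \<open>h\<close> between \<open>K\<close> and \<open>U\<close>, the indicator of \<open>A\<close> and \<open>h\<close> differ only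
  on \<open>U - K\<close> and by at most \<open>1\<close> there. Uniform absolute continuity makes this error uniform in \<open>n\<close>.
\<close>

theorem vague_and_uniformly_ac_imp_setwise:
  fixes m :: "'a::t2_space measure"
  assumes lc: "locally_compact_space (euclidean :: 'a topology)"
    and m: "m \<in> finite_borel_measures" and ms: "\<And>n. ms n \<in> finite_borel_measures"
    and "radon_measure m" and vague: "vaguely_convergent ms m"
    and uac: "uniformly_absolutely_continuous ms m"
  shows "setwise_convergence m ms"
proof (rule setwise_convergence.intro)
  have fin: "finite_measure m" and fin_n: "\<And>n. finite_measure (ms n)"
    and sets_m: "sets m = sets borel" and sets_n: "\<And>n. sets (ms n) = sets borel"
    using m ms by (auto simp: finite_borel_measures_def)
  show "finite_measure m" "\<And>n. finite_measure (ms n)" "\<And>n. sets (ms n) = sets m"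
    using fin fin_n sets_m sets_n by auto
  fix A assume "A \<in> sets m"
  then have A: "A \<in> sets borel" using sets_m by simp
  show "(\<lambda>n. measure (ms n) A) \<longlonglongrightarrow> measure m A"
  proof (rule tendsto_if_approximable)
    fix \<epsilon> :: real assume "\<epsilon> > 0"
    obtain \<delta> where "\<delta> > 0"
      and \<delta>: "\<And>E n. E \<in> sets m \<Longrightarrow> measure m E < \<delta> \<Longrightarrow> measure (ms n) E < \<epsilon>"
      using uniformly_absolutely_continuousD[OF uac fin fin_n \<open>\<epsilon> > 0\<close>] by blast
    have "min \<delta> \<epsilon> > 0" using \<open>\<delta> > 0\<close> \<open>\<epsilon> > 0\<close> by simp
    then obtain K U where K: "compact K" "open U" "K \<subseteq> A" "A \<subseteq> U"
      and small: "measure m (U - K) < min \<delta> \<epsilon>"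
      using finite_radon_approximation[OF fin sets_m \<open>radon_measure m\<close> A] by blast
    obtain h where h: "h \<in> C0_functions" "\<And>t. 0 \<le> h t" "\<And>t. h t \<le> 1"
      "\<And>t. t \<in> K \<Longrightarrow> h t = 1" "\<And>t. t \<notin> U \<Longrightarrow> h t = 0"
      using urysohn_C0_function[OF lc K(1,2)] K(3,4) by (metis order_trans)
    have "continuous_on UNIV h" using h(1) by (simp add: C0_functions_def)
    then have h_meas [measurable]: "h \<in> borel_measurable borel" by (rule borel_measurable_continuous_onI)
    have UK: "U - K \<in> sets borel" using K(1,2) by (auto simp: borel_compact)
    have close: "\<bar>measure \<mu> A - (\<integral>t. h t \<partial>\<mu>)\<bar> \<le> measure \<mu> (U - K)"
      if "finite_measure \<mu>" and sets: "sets \<mu> = sets borel" for \<mu>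
    proof -
      interpret \<mu>: finite_measure \<mu> by fact
      note [measurable_cong] = sets
      note [measurable] = A UK
      have int_h: "integrable \<mu> h"
        using h(2,3) by (intro \<mu>.integrable_const_bound[where B = 1]) auto
      have int: "integrable \<mu> (indicator B :: 'a \<Rightarrow> real)" if [measurable]: "B \<in> sets borel" for B
        by (intro \<mu>.integrable_const_bound[where B = 1]) auto
      have "measure \<mu> A = (\<integral>t. indicator A t \<partial>\<mu>)" using A by (simp add: sets)
      then have "\<bar>measure \<mu> A - (\<integral>t. h t \<partial>\<mu>)\<bar> = \<bar>\<integral>t. indicator A t - h t \<partial>\<mu>\<bar>"
        using int[OF A] int_h by simp
      also have "\<dots> \<le> (\<integral>t. \<bar>indicator A t - h t\<bar> \<partial>\<mu>)" by (rule integral_abs_bound)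
      also have "\<dots> \<le> (\<integral>t. indicator (U - K) t \<partial>\<mu>)"
      proof (intro integral_mono integrable_abs Bochner_Integration.integrable_diff int A UK int_h)
        show "\<bar>indicator A t - h t\<bar> \<le> indicator (U - K) t" for t
          using h(2)[of t] h(3)[of t] h(4)[of t] h(5)[of t] K(3,4)
          by (auto simp: indicator_def)
      qed
      also have "\<dots> = measure \<mu> (U - K)" using UK by (simp add: sets)
      finally show ?thesis .
    qed
    show "\<exists>b b'. b \<longlonglongrightarrow> b' \<and> \<bar>measure m A - b'\<bar> \<le> \<epsilon> \<and>
        (\<forall>\<^sub>F n in sequentially. \<bar>measure (ms n) A - b n\<bar> \<le> \<epsilon>)"
    proof (intro exI conjI)
      show "(\<lambda>n. \<integral>t. h t \<partial>ms n) \<longlonglongrightarrow> (\<integral>t. h t \<partial>m)"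
        using vague h(1) by (simp add: vaguely_convergent_def)
      show "\<bar>measure m A - (\<integral>t. h t \<partial>m)\<bar> \<le> \<epsilon>"
        using close[OF fin sets_m] small by simp
      have "measure (ms n) (U - K) < \<epsilon>" for n
        using \<delta>[of "U - K" n] UK sets_m small by simp
      then show "\<forall>\<^sub>F n in sequentially. \<bar>measure (ms n) A - (\<integral>t. h t \<partial>ms n)\<bar> \<le> \<epsilon>"
        using close[OF fin_n sets_n] by (intro always_eventually allI) (meson less_imp_le order_trans)
    qed
  qed
qed

section \<open>Pettis integrals as weak limits\<close>

text \<open>
  A substitute for a weak* cluster point: the pointwise limit is a bounded functional on the
  subspace where it exists, and Hahn-Banach extends it.
\<close>

lemma pointwise_limit_functional:
  fixes w :: "nat \<Rightarrow> 'x::real_normed_vector \<Rightarrow>\<^sub>L real"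
  assumes "\<And>j. norm (w j) \<le> 1"
  shows "\<exists>F :: 'x \<Rightarrow>\<^sub>L real. norm F \<le> 1 \<and> (\<forall>x. convergent (\<lambda>j. w j x) \<longrightarrow> (\<lambda>j. w j x) \<longlonglongrightarrow> blinfun_apply F x)"
proof -
  define S where "S = {x. convergent (\<lambda>j. w j x)}"
  have conv: "(\<lambda>j. w j x) \<longlonglongrightarrow> lim (\<lambda>j. w j x)" if "x \<in> S" for x
    using that by (simp add: S_def convergent_LIMSEQ_iff)
  have "subspace S"
    by (rule subspaceI)
      (auto simp: S_def blinfun.add_right blinfun.scaleR_right convergent_const
        intro!: convergent_add convergent_mult)
  moreover have "lim (\<lambda>j. w j (x + y)) = lim (\<lambda>j. w j x) + lim (\<lambda>j. w j y)" if "x \<in> S" "y \<in> S" for x y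
    unfolding blinfun.add_right by (intro limI tendsto_add conv that)
  moreover have "lim (\<lambda>j. w j (c *\<^sub>R x)) = c * lim (\<lambda>j. w j x)" if "x \<in> S" for c x
    unfolding blinfun.scaleR_right real_scaleR_def by (intro limI tendsto_mult_left conv that)
  moreover have "\<bar>lim (\<lambda>j. w j x)\<bar> \<le> 1 * norm x" if "x \<in> S" for x
  proof (rule tendsto_upperbound[OF tendsto_rabs[OF conv[OF that]]])
    have "\<bar>w j x\<bar> \<le> 1 * norm x" for j
      using norm_blinfun[of "w j" x] mult_right_mono[OF assms[of j], of "norm x"] by simp
    then show "\<forall>\<^sub>F j in sequentially. \<bar>w j x\<bar> \<le> 1 * norm x" by simp
  qed simp
  ultimately obtain F :: "'x \<Rightarrow>\<^sub>L real" where F: "\<And>x. x \<in> S \<Longrightarrow> F x = lim (\<lambda>j. w j x)" "norm F \<le> 1"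
    using hahn_banach_extension[of S "\<lambda>x. lim (\<lambda>j. w j x)" 1] by (metis zero_le_one)
  have "(\<lambda>j. w j x) \<longlonglongrightarrow> F x" if "convergent (\<lambda>j. w j x)" for x
    using conv[of x] F(1)[of x] that by (simp add: S_def)
  then show ?thesis using F(2) by blast
qed

text \<open>
  If the functional \<open>L f = \<integral>\<^sub>A f (g t) dm\<close> were not an evaluation, there would be a functional \<open>F\<close> that
  kills all \<open>x n\<close>, so \<open>L F = 0\<close> by the weak convergence, and that is on the range of \<open>g\<close> an almost
  everywhere limit of functionals \<open>w j\<close> in the unit ball with \<open>L (w j) \<ge> \<epsilon>\<close>, so \<open>L F \<ge> \<epsilon>\<close> by Vitali.
\<close>

theorem weak_limit_of_vectors_has_pettis_integral:
  fixes g :: "'a \<Rightarrow> 'x::banach"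
  assumes "finite_measure m" and int: "scalarly_integrable m g"
    and ac: "\<And>\<epsilon>. \<epsilon> > 0 \<Longrightarrow> \<exists>\<delta>>0. \<forall>f :: 'x \<Rightarrow>\<^sub>L real. norm f \<le> 1 \<longrightarrow> (\<forall>B\<in>sets m. measure m B < \<delta> \<longrightarrow>
        (\<integral>\<^sup>+t\<in>B. ennreal \<bar>blinfun_apply f (g t)\<bar> \<partial>m) \<le> ennreal \<epsilon>)"
    and A [measurable]: "A \<in> sets m"
    and weak: "\<And>f :: 'x \<Rightarrow>\<^sub>L real. (\<lambda>n. blinfun_apply f (x n)) \<longlonglongrightarrow> (LINT t:A|m. blinfun_apply f (g t))"
  shows "\<exists>y. has_pettis_integral m A g y"
proof (rule ccontr)
  assume no: "\<nexists>y. has_pettis_integral m A g y"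
  interpret finite_measure m by fact
  interpret const: setwise_convergence m "\<lambda>_. m" by unfold_locales auto
  define L where "L f = (LINT t:A|m. f (g t))" for f :: "'x \<Rightarrow>\<^sub>L real"
  have int_f: "integrable m (\<lambda>t. f (g t))" for f :: "'x \<Rightarrow>\<^sub>L real"
    using int by (simp add: scalarly_integrable_def)
  have int_A: "set_integrable m A (\<lambda>t. f (g t))" for f :: "'x \<Rightarrow>\<^sub>L real"
    unfolding set_integrable_def by (intro integrable_mult_indicator A int_f)
  have "linear L"
    by (rule linearI) (auto simp: L_def blinfun.add_left blinfun.scaleR_left set_integral_add int_A)
  moreover have "\<nexists>y. \<forall>f. L f = blinfun_apply f y"
    using no unfolding has_pettis_integral_def L_def by metis
  ultimately obtain \<epsilon> where "\<epsilon> > 0"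
    and sep: "\<And>D. finite D \<Longrightarrow> \<exists>f. norm f \<le> 1 \<and> (\<forall>y\<in>D. blinfun_apply f y = 0) \<and> L f > \<epsilon>"
    using evaluation_or_separated_from_finite_sets[of L] by blast
  have "\<forall>k. \<exists>f. norm f \<le> 1 \<and> (\<forall>i\<le>k. blinfun_apply f (x i) = 0) \<and> L f > \<epsilon>"
  proof
    fix k :: nat
    show "\<exists>f. norm f \<le> 1 \<and> (\<forall>i\<le>k. blinfun_apply f (x i) = 0) \<and> L f > \<epsilon>"
      using sep[of "x ` {..k}"] by auto
  qed
  then obtain z where z: "\<And>k. norm (z k) \<le> 1" "\<And>k i. i \<le> k \<Longrightarrow> blinfun_apply (z k) (x i) = 0"
    "\<And>k. L (z k) > \<epsilon>" by metis
  have "bdd_above (range (\<lambda>k. \<bar>blinfun_apply (z k) (g t)\<bar>))" for t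
  proof (rule bdd_aboveI2)
    show "\<bar>blinfun_apply (z k) (g t)\<bar> \<le> norm (g t)" for k
      using norm_blinfun[of "z k" "g t"] mult_right_mono[OF z(1)[of k], of "norm (g t)"] by simp
  qed
  moreover have "linear (\<lambda>f. blinfun_apply f (g t))" for t
    by (rule linearI) (auto simp: blinfun.add_left blinfun.scaleR_left)
  ultimately obtain w where w: "\<And>j. w j \<in> convex hull (z ` {j..})"
    and w_conv: "AE t in m. convergent (\<lambda>j. blinfun_apply (w j) (g t))"
    using forward_convex_combinations_converge_AE[OF \<open>finite_measure m\<close>, of "\<lambda>f t. blinfun_apply f (g t)" z]
      borel_measurable_integrable[OF int_f] by blast
  \<comment> \<open>every convex property of a tail of \<open>z\<close> passes to the convex combinations\<close>
  have w_in: "w j \<in> S" if "convex S" "\<And>k. k \<ge> j \<Longrightarrow> z k \<in> S" for j S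
    using w[of j] hull_minimal[of "z ` {j..}" S convex] that by blast
  have w_norm: "norm (w j) \<le> 1" for j
    using w_in[of "cball 0 1" j] z(1) by simp
  have w_x: "blinfun_apply (w j) (x i) = 0" if "i \<le> j" for i j
  proof -
    have "linear (\<lambda>f. blinfun_apply f (x i))"
      by (rule linearI) (auto simp: blinfun.add_left blinfun.scaleR_left)
    then have "convex ((\<lambda>f. blinfun_apply f (x i)) -` {0})" by (rule convex_linear_vimage) simp
    from w_in[OF this, of j] show ?thesis using z(2) that by auto
  qed
  have w_L: "L (w j) \<ge> \<epsilon>" for j
    using w_in[OF convex_linear_vimage[OF \<open>linear L\<close>, of "{\<epsilon>..}"], of j] z(3)
    by (auto intro: less_imp_le)
  obtain F :: "'x \<Rightarrow>\<^sub>L real" where "norm F \<le> 1"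
    and F: "\<And>y. convergent (\<lambda>j. blinfun_apply (w j) y) \<Longrightarrow> (\<lambda>j. blinfun_apply (w j) y) \<longlonglongrightarrow> F y"
    using pointwise_limit_functional[of w] w_norm by blast
  have equi: "uniformly_ac_integrals (\<lambda>_. m) (\<lambda>n t. blinfun_apply (fs n) (g t))" if "\<And>n. norm (fs n) \<le> 1" for fs :: "nat \<Rightarrow> 'x \<Rightarrow>\<^sub>L real"
    unfolding uniformly_ac_integrals_def
  proof (intro allI impI)
    fix \<epsilon> :: real assume "\<epsilon> > 0"
    from ac[OF this] that show "\<exists>\<delta>>0. \<forall>n. \<forall>A\<in>sets m. measure m A < \<delta> \<longrightarrow>
      (\<integral>\<^sup>+t\<in>A. ennreal \<bar>blinfun_apply (fs n) (g t)\<bar> \<partial>m) \<le> ennreal \<epsilon>" by blast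
  qed
  have "(\<lambda>j. LINT t:A|m. blinfun_apply (w j) (g t)) \<longlonglongrightarrow> (LINT t:A|m. F (g t))"
  proof (rule const.vitali_convergence_varying_measures[OF A
        borel_measurable_integrable[OF int_f] borel_measurable_integrable[OF int_f] int_f int_f])
    show "uniformly_ac_integrals (\<lambda>_. m) (\<lambda>_ t. F (g t))" using equi[of "\<lambda>_. F"] \<open>norm F \<le> 1\<close> by simp
    show "uniformly_ac_integrals (\<lambda>_. m) (\<lambda>n t. w n (g t))" by (rule equi[OF w_norm])
    show "\<exists>\<delta>>0. \<forall>E\<in>sets m. measure m E < \<delta> \<longrightarrow> (\<forall>n::nat. measure m E < \<eta>)" if "\<eta> > 0" for \<eta> :: real
      using that by blast
    show "AE t in m. (\<lambda>j. blinfun_apply (w j) (g t)) \<longlonglongrightarrow> F (g t)"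
      using w_conv by eventually_elim (rule F)
  qed
  then have "\<epsilon> \<le> L F"
    using w_L by (intro tendsto_lowerbound[of "\<lambda>j. L (w j)"]) (auto simp: L_def)
  moreover have "F (x i) = 0" for i
  proof -
    have "\<forall>\<^sub>F j in sequentially. blinfun_apply (w j) (x i) = 0"
      using eventually_ge_at_top[of i] by eventually_elim (rule w_x)
    then have lim0: "(\<lambda>j. blinfun_apply (w j) (x i)) \<longlonglongrightarrow> 0" by (rule tendsto_eventually)
    then have "(\<lambda>j. blinfun_apply (w j) (x i)) \<longlonglongrightarrow> F (x i)" by (intro F convergentI)
    then show ?thesis using lim0 by (rule LIMSEQ_unique)
  qed
  then have "L F = 0" using weak[of F] by (simp add: L_def LIMSEQ_const_iff)
  ultimately show False using \<open>\<epsilon> > 0\<close> by simp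
qed

lemma scalarly_uniformly_ac_integrals_unit_ball:
  fixes gs :: "nat \<Rightarrow> 'a \<Rightarrow> 'x::real_normed_vector"
  assumes "scalarly_uniformly_ac_integrals ms gs" "\<And>n. finite_measure (ms n)" and "\<epsilon> > 0"
  obtains \<delta> :: real where "\<delta> > 0"
    "\<And>(f :: 'x \<Rightarrow>\<^sub>L real) n A. norm f \<le> 1 \<Longrightarrow> A \<in> sets (ms n) \<Longrightarrow> measure (ms n) A < \<delta> \<Longrightarrow>
      (\<integral>\<^sup>+t\<in>A. ennreal \<bar>blinfun_apply f (gs n t)\<bar> \<partial>ms n) \<le> ennreal \<epsilon>"
proof -
  obtain \<delta> :: real where "\<delta> > 0" and \<delta>: "\<forall>n. \<forall>A\<in>sets (ms n). emeasure (ms n) A < ennreal \<delta> \<longrightarrow>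
      (SUP f\<in>{f :: 'x \<Rightarrow>\<^sub>L real. norm f \<le> 1}. \<integral>\<^sup>+t\<in>A. ennreal \<bar>blinfun_apply f (gs n t)\<bar> \<partial>(ms n)) < ennreal \<epsilon>"
    using assms(1,3) unfolding scalarly_uniformly_ac_integrals_def by blast
  show ?thesis
  proof (rule that[OF \<open>\<delta> > 0\<close>])
    fix f :: "'x \<Rightarrow>\<^sub>L real" and n A
    assume f: "norm f \<le> 1" and A: "A \<in> sets (ms n)" "measure (ms n) A < \<delta>"
    interpret finite_measure "ms n" by fact
    have "emeasure (ms n) A < ennreal \<delta>"
      using A(2) \<open>\<delta> > 0\<close> by (simp add: emeasure_eq_measure ennreal_lessI)
    then have "(SUP f\<in>{f :: 'x \<Rightarrow>\<^sub>L real. norm f \<le> 1}. \<integral>\<^sup>+t\<in>A. ennreal \<bar>blinfun_apply f (gs n t)\<bar> \<partial>(ms n)) < ennreal \<epsilon>"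
      using \<delta> A(1) by blast
    then show "(\<integral>\<^sup>+t\<in>A. ennreal \<bar>blinfun_apply f (gs n t)\<bar> \<partial>ms n) \<le> ennreal \<epsilon>"
      by (intro order_trans[OF SUP_upper less_imp_le]) (use f in auto)
  qed
qed

text \<open>
  The unit ball bound, rescaled to a functional of arbitrary norm; adding \<open>1\<close> to the norm avoids
  dividing by zero.
\<close>

lemma scalarly_uniformly_ac_integralsD:
  fixes gs :: "nat \<Rightarrow> 'a \<Rightarrow> 'x::real_normed_vector" and f :: "'x \<Rightarrow>\<^sub>L real"
  assumes "scalarly_uniformly_ac_integrals ms gs" "\<And>n. finite_measure (ms n)"
  shows "uniformly_ac_integrals ms (\<lambda>n t. blinfun_apply f (gs n t))"
  unfolding uniformly_ac_integrals_def
proof (intro allI impI)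
  fix \<epsilon> :: real assume "\<epsilon> > 0"
  define c where "c = 1 + norm f"
  have "c > 0" by (simp add: c_def add_pos_nonneg)
  then have "\<epsilon> / c > 0" using \<open>\<epsilon> > 0\<close> by simp
  then obtain \<delta> :: real where "\<delta> > 0" and \<delta>:
    "\<And>(f :: 'x \<Rightarrow>\<^sub>L real) n A. norm f \<le> 1 \<Longrightarrow> A \<in> sets (ms n) \<Longrightarrow> measure (ms n) A < \<delta> \<Longrightarrow>
      (\<integral>\<^sup>+t\<in>A. ennreal \<bar>blinfun_apply f (gs n t)\<bar> \<partial>ms n) \<le> ennreal (\<epsilon> / c)"
    using scalarly_uniformly_ac_integrals_unit_ball[OF assms] by metis
  have "(\<integral>\<^sup>+t\<in>A. ennreal \<bar>blinfun_apply f (gs n t)\<bar> \<partial>ms n) \<le> ennreal \<epsilon>"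
    if [measurable]: "A \<in> sets (ms n)" and "measure (ms n) A < \<delta>" for n A
  proof -
    have "integrable (ms n) (\<lambda>t. h (gs n t))" for h :: "'x \<Rightarrow>\<^sub>L real"
      using assms(1) by (simp add: scalarly_uniformly_ac_integrals_def scalarly_integrable_def)
    then have [measurable]: "(\<lambda>t. blinfun_apply h (gs n t)) \<in> borel_measurable (ms n)" for h :: "'x \<Rightarrow>\<^sub>L real"
      by (rule borel_measurable_integrable)
    have "norm (f /\<^sub>R c) \<le> 1" using \<open>c > 0\<close> by (simp add: c_def field_simps)
    from \<delta>[OF this that]
    have le: "(\<integral>\<^sup>+t\<in>A. ennreal \<bar>blinfun_apply (f /\<^sub>R c) (gs n t)\<bar> \<partial>ms n) \<le> ennreal (\<epsilon> / c)" .
    have "ennreal \<bar>blinfun_apply f y\<bar> = ennreal c * ennreal \<bar>blinfun_apply (f /\<^sub>R c) y\<bar>" for y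
      using \<open>c > 0\<close> by (simp add: blinfun.scaleR_left abs_mult flip: ennreal_mult)
    then have "(\<integral>\<^sup>+t\<in>A. ennreal \<bar>blinfun_apply f (gs n t)\<bar> \<partial>ms n)
        = (\<integral>\<^sup>+t. ennreal c * (ennreal \<bar>blinfun_apply (f /\<^sub>R c) (gs n t)\<bar> * indicator A t) \<partial>ms n)"
      by (simp add: mult.assoc)
    also have "\<dots> = ennreal c * (\<integral>\<^sup>+t\<in>A. ennreal \<bar>blinfun_apply (f /\<^sub>R c) (gs n t)\<bar> \<partial>ms n)"
      by (rule nn_integral_cmult) measurable
    also have "\<dots> \<le> ennreal c * ennreal (\<epsilon> / c)" by (intro mult_left_mono le) simp
    also have "\<dots> = ennreal \<epsilon>" using \<open>c > 0\<close> \<open>\<epsilon> > 0\<close> by (simp flip: ennreal_mult)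
    finally show ?thesis .
  qed
  then show "\<exists>\<delta>>0. \<forall>n. \<forall>A\<in>sets (ms n). measure (ms n) A < \<delta> \<longrightarrow>
      (\<integral>\<^sup>+t\<in>A. ennreal \<bar>blinfun_apply f (gs n t)\<bar> \<partial>ms n) \<le> ennreal \<epsilon>"
    using \<open>\<delta> > 0\<close> by blast
qed

lemma has_pettis_integral_pettis_integral:
  assumes "\<exists>y. has_pettis_integral M A g y"
  shows "has_pettis_integral M A g (pettis_integral M A g)"
  unfolding pettis_integral_def using assms by (rule someI_ex)

section \<open>The limit theorem for Pettis integrals\<close>

text \<open>
  For each functional \<open>f\<close> the Vitali theorem gives the convergence of \<open>f (\<integral>\<^sub>A gs n d(ms n))\<close> to
  \<open>\<integral>\<^sub>A f (g t) dm\<close>; the absolute continuity of the integrals of \<open>f (g t)\<close>, uniform over the unit ball,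
  passes from the \<open>ms n\<close> to \<open>m\<close>, and \<open>weak_limit_of_vectors_has_pettis_integral\<close> applies.
\<close>

theorem corollary4p3:
  fixes m :: "'a::t2_space measure" and ms :: "nat \<Rightarrow> 'a measure"
    and g :: "'a \<Rightarrow> 'x::banach" and gs :: "nat \<Rightarrow> 'a \<Rightarrow> 'x"
  assumes "locally_compact_space (euclidean :: 'a topology)"
    and "scalarly_measurable borel g" and "\<And>n. scalarly_measurable borel (gs n)"
    and "m \<in> finite_borel_measures" and "\<And>n. ms n \<in> finite_borel_measures"
    and "radon_measure m"
    and "scalarly_uniformly_ac_integrals ms gs"
    and "scalarly_uniformly_ac_integrals ms (\<lambda>_. g)"
    and "\<And>f :: 'x \<Rightarrow>\<^sub>L real. AE t in m. (\<lambda>n. f (gs n t)) \<longlonglongrightarrow> f (g t)"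
    and "scalarly_continuous g"
    and "vaguely_convergent ms m"
    and "uniformly_absolutely_continuous ms m"
    and "\<And>n. pettis_integrable (ms n) (gs n)"
  shows "pettis_integrable m g \<and>
    (\<forall>f :: 'x \<Rightarrow>\<^sub>L real. \<forall>A\<in>sets borel.
       (\<lambda>n. f (pettis_integral (ms n) A (gs n))) \<longlonglongrightarrow> f (pettis_integral m A g))"
proof -
  have fin: "finite_measure m" and fin_n: "\<And>n. finite_measure (ms n)" and sets_m: "sets m = sets borel"
    using assms(4,5) by (auto simp: finite_borel_measures_def)
  interpret setwise_convergence m ms
    by (rule vague_and_uniformly_ac_imp_setwise[OF assms(1,4,5,6,11,12)])
  have meas: "(\<lambda>t. blinfun_apply f (g t)) \<in> borel_measurable m"
    "(\<lambda>t. blinfun_apply f (gs n t)) \<in> borel_measurable m" for f :: "'x \<Rightarrow>\<^sub>L real" and n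
    using assms(2,3) by (auto simp: scalarly_measurable_def cong: measurable_cong_sets[OF sets_m refl])
  have ac: "uniformly_ac_integrals ms (\<lambda>_ t. blinfun_apply f (g t))" "uniformly_ac_integrals ms (\<lambda>n t. blinfun_apply f (gs n t))" for f :: "'x \<Rightarrow>\<^sub>L real"
    using assms(7,8) fin_n by (auto intro: scalarly_uniformly_ac_integralsD)
  have int_m: "scalarly_integrable m g"
    using uniformly_ac_imp_limit_integrable[OF meas(1) ac(1)] by (simp add: scalarly_integrable_def)
  have ball: "\<exists>\<delta>>0. \<forall>f :: 'x \<Rightarrow>\<^sub>L real. norm f \<le> 1 \<longrightarrow> (\<forall>B\<in>sets m. measure m B < \<delta> \<longrightarrow>
      (\<integral>\<^sup>+t\<in>B. ennreal \<bar>blinfun_apply f (g t)\<bar> \<partial>m) \<le> ennreal \<epsilon>)" if "\<epsilon> > 0" for \<epsilon>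
  proof -
    obtain \<delta> :: real where "\<delta> > 0" and \<delta>:
      "\<And>(f :: 'x \<Rightarrow>\<^sub>L real) n A. norm f \<le> 1 \<Longrightarrow> A \<in> sets (ms n) \<Longrightarrow> measure (ms n) A < \<delta> \<Longrightarrow>
        (\<integral>\<^sup>+t\<in>A. ennreal \<bar>blinfun_apply f (g t)\<bar> \<partial>ms n) \<le> ennreal \<epsilon>"
      using scalarly_uniformly_ac_integrals_unit_ball[OF assms(8) fin_n \<open>\<epsilon> > 0\<close>] by metis
    have "(\<integral>\<^sup>+t\<in>B. ennreal \<bar>blinfun_apply f (g t)\<bar> \<partial>m) \<le> ennreal \<epsilon>"
      if "norm f \<le> 1" "B \<in> sets m" "measure m B < \<delta>" for f :: "'x \<Rightarrow>\<^sub>L real" and B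
      using \<delta>[OF that(1)] \<open>\<epsilon> > 0\<close>
      by (intro limit_inherits_absolute_continuity[OF meas(1) _ _ that(2,3)]) auto
    then show ?thesis using \<open>\<delta> > 0\<close> by blast
  qed
  have lim: "(\<lambda>n. blinfun_apply f (pettis_integral (ms n) A (gs n))) \<longlonglongrightarrow> (LINT t:A|m. blinfun_apply f (g t))"
    if A: "A \<in> sets m" for f :: "'x \<Rightarrow>\<^sub>L real" and A
  proof -
    have "has_pettis_integral (ms n) A (gs n) (pettis_integral (ms n) A (gs n))" for n
      using assms(13)[of n] A by (intro has_pettis_integral_pettis_integral) (simp add: pettis_integrable_def)
    then have "blinfun_apply f (pettis_integral (ms n) A (gs n)) = (LINT t:A|ms n. blinfun_apply f (gs n t))" for n
      by (simp add: has_pettis_integral_def)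
    moreover have "(\<lambda>n. LINT t:A|ms n. blinfun_apply f (gs n t)) \<longlonglongrightarrow> (LINT t:A|m. blinfun_apply f (g t))"
    proof (rule vitali_convergence_varying_measures[OF A meas(1) meas(2) _ _ ac])
      show "integrable (ms n) (\<lambda>t. blinfun_apply f (g t))" "integrable (ms n) (\<lambda>t. blinfun_apply f (gs n t))" for n
        using assms(7,8) by (simp_all add: scalarly_uniformly_ac_integrals_def scalarly_integrable_def)
    qed (use uniformly_absolutely_continuousD[OF assms(12) fin fin_n] assms(9) in blast)+
    ultimately show ?thesis by simp
  qed
  have exists: "\<exists>y. has_pettis_integral m A g y" if "A \<in> sets m" for A
    by (rule weak_limit_of_vectors_has_pettis_integral[OF fin int_m ball that lim[OF that]])
  then have "pettis_integrable m g"
    using int_m by (simp add: pettis_integrable_def)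
  moreover have "(\<lambda>n. blinfun_apply f (pettis_integral (ms n) A (gs n))) \<longlonglongrightarrow> blinfun_apply f (pettis_integral m A g)"
    if "A \<in> sets borel" for f :: "'x \<Rightarrow>\<^sub>L real" and A
  proof -
    have A: "A \<in> sets m" using that sets_m by simp
    show ?thesis
      using lim[OF A, of f] has_pettis_integral_pettis_integral[OF exists[OF A]]
      by (simp add: has_pettis_integral_def)
  qed
  ultimately show ?thesis by blast
qed

end
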